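(* Let $0<\alpha<2$ and $D\ge 1$. Let $u=(u_1,\dots,u_D)$ and $v=(v_1,\dots,v_D)$ be nonnegative vectors ($u_i\ge 0$, $v_i\ge 0$), each having at least one strictly positive entry. Let $r_1,\dots,r_D$ be i.i.d. symmetric $\alpha$-stable random variables with characteristic function $E\,e^{\sqrt{-1}\,t r_i}=e^{-|t|^\alpha}$, and set $x=\sum_{i=1}^D u_i r_i$, $y=\sum_{i=1}^D v_i r_i$. Let $T_1,\dots,T_D$ be i.i.d. positive random variables with Laplace transform $E\,e^{-sT_i}=e^{-s^{\alpha/2}}$ for $s\ge 0$ (i.e. maximally skewed $\alpha/2$-stable, $T_i\sim S(\alpha/2,1,\cos(\pi\alpha/4))$). Then $$\Pr\big(\mathrm{sign}(x)\neq \mathrm{sign}(y)\big)=E\left(\frac{1}{\pi}\cos^{-1}\left(\frac{\sum_{i=1}^D u_iv_iT_i}{\sqrt{\sum_{i=1}^D u_i^2T_i\sum_{i=1}^D v_i^2T_i}}\right)\right)\le \frac{1}{\pi}\cos^{-1}\rho_\alpha,$$ where $$\rho_\alpha=\left(\frac{\sum_{i=1}^D u_i^{\alpha/2}v_i^{\alpha/2}}{\sqrt{\sum_{i=1}^D u_i^{\alpha}\sum_{i=1}^D v_i^{\alpha}}}\right)^{2/\alpha}.$$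
   Context: $\cos^{-1}$ denotes the principal arccosine with values in $[0,\pi]$. $\mathrm{sign}(\cdot)$ is the sign function; since $x,y$ have continuous distributions, $x=0$ or $y=0$ occurs with probability zero. *)

theory Defs
  imports "HOL-Probability.Probability"
begin

end

theory Submission
  imports Defs
begin

text \<open>Conditionally on $T$ the mixture $r_i = \sqrt{2T_i} Z_i$ with standard normal $Z_i$ makes $(x, y)$ a
  planar Gaussian, whose signs disagree with probability $\theta/\pi$ for the angle $\theta$ with
  $\cos\theta = W$, where $W$ is the ratio under the arccosine.

  For the bound, $\ln W = \ln \sum u_iv_iT_i - \frac12 \ln \sum u_i^2T_i - \frac12 \ln \sum v_i^2T_i$, and
  each sum is a multiple of a single $\alpha/2$-stable variable, so $E \ln W = \ln \rho_\alpha$. As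
  $l \mapsto \arccos (e^l)$ is concave for $l \le 0$, Jensen's inequality gives the claim.\<close>

subsection \<open>Uniqueness of planar characteristic functions\<close>

text \<open>Nothing is assumed about the joint law of \<open>r\<close> and \<open>T\<close>, so the
  mixture cannot be located on \<open>M\<close> itself: the normals live on a product space and only
  laws are compared. This requires uniqueness of characteristic functions in two dimensions, which
  is why that comes before any probability of signs. The 2 under the root cancels the 1/2 in the
  Gaussian exponent: given T, the exponent at (s, t) is minus the sum of (s u_i + t v_i)^2 T_i, and
  the Laplace transform of T at 1 turns each square into |s u_i + t v_i|^\<alpha>. The mean
  logarithm of a single stable variable enters E ln W with total weight 1 - 1/2 - 1/2 = 0, so it has
  to be finite but never has to be evaluated. Two cases escape the concavity argument: disjoint
  supports of u and v, where W = 0 has no logarithm, and \<rho> = 1, where the tangent is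
  vertical.\<close>

lemma finite_measure_eqI_char:
  fixes \<mu> \<nu> :: "real measure"
  assumes fin: "finite_measure \<mu>" "finite_measure \<nu>" and s: "sets \<mu> = sets borel" "sets \<nu> = sets borel"
    and eq: "\<And>t. char \<mu> t = char \<nu> t"
  shows "\<mu> = \<nu>"
proof -
  interpret \<mu>: finite_measure \<mu> by fact
  interpret \<nu>: finite_measure \<nu> by fact
  have sp: "space \<mu> = UNIV" "space \<nu> = UNIV" using s[THEN sets_eq_imp_space_eq] by auto
  \<comment> \<open>The value of a characteristic function at 0 is the total mass, so both measures
    have the same mass \<open>m\<close>. Scaling both by \<open>1 / m\<close> gives probability
    measures, for which Levy uniqueness is available; mass 0 is settled directly.\<close>
  define m where "m = measure \<mu> UNIV"
  have m': "measure \<nu> UNIV = m"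
    using eq[of 0] sp by (simp add: char_def m_def)
  show ?thesis
  proof (cases "m = 0")
    case True
    have "emeasure \<mu> A = emeasure \<nu> A" for A
    proof -
      have "emeasure \<mu> A \<le> emeasure \<mu> (space \<mu>)" "emeasure \<nu> A \<le> emeasure \<nu> (space \<nu>)"
        by (auto intro: emeasure_space)
      moreover have "emeasure \<mu> (space \<mu>) = 0" "emeasure \<nu> (space \<nu>) = 0"
        using True m' sp by (simp_all add: m_def \<mu>.emeasure_eq_measure \<nu>.emeasure_eq_measure)
      ultimately show ?thesis by simp
    qed
    thus ?thesis using s by (intro measure_eqI) auto
  next
    case False
    hence pos: "m > 0" by (simp add: m_def less_le)
    let ?N = "\<lambda>\<mu>. density \<mu> (\<lambda>_. ennreal (1 / m))"
    have rd: "real_distribution (?N \<mu>)" if "emeasure \<mu> (space \<mu>) = ennreal m" "sets \<mu> = sets borel" for \<mu>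
    proof -
      have "prob_space (?N \<mu>)"
        by (rule prob_spaceI)
           (use that pos in \<open>simp add: emeasure_density_const[OF sets.top] ennreal_mult[symmetric] del: sets.top\<close>)
      thus ?thesis using that(2) by (auto simp: real_distribution_def real_distribution_axioms_def)
    qed
    have ch: "char (?N \<mu>) t = char \<mu> t / m" if "sets \<mu> = sets borel" for \<mu> t
      unfolding char_def using that pos
      by (subst integral_density) (auto simp: measurable_cong_sets[OF that refl] scaleR_conv_of_real)
    have "?N \<mu> = ?N \<nu>"
    proof (rule Levy_uniqueness)
      show "real_distribution (?N \<mu>)" "real_distribution (?N \<nu>)"
        by (rule rd; use m' sp s in \<open>simp add: m_def \<mu>.emeasure_eq_measure \<nu>.emeasure_eq_measure\<close>)+
      show "char (?N \<mu>) = char (?N \<nu>)" by (rule ext) (simp add: ch s eq)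
    qed
    hence *: "emeasure (?N \<mu>) A = emeasure (?N \<nu>) A" for A by simp
    show ?thesis
    proof (rule measure_eqI)
      fix A assume A: "A \<in> sets \<mu>"
      have "ennreal (1 / m) * emeasure \<mu> A = ennreal (1 / m) * emeasure \<nu> A"
        using *[of A] A s by (simp add: emeasure_density_const)
      thus "emeasure \<mu> A = emeasure \<nu> A" using pos by (simp add: ennreal_mult_cancel_left)
    qed (simp add: s)
  qed
qed

text \<open>Uniqueness in the plane is reduced to the line twice: weighting a measure by
  $1 + \cos (t y + p)$ keeps it positive, and the characteristic function of its first
  marginal is a combination of values of the planar characteristic function.\<close>

lemma Levy_uniqueness_pair:
  fixes \<mu> \<nu> :: "(real \<times> real) measure"
  assumes prob: "prob_space \<mu>" "prob_space \<nu>"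
    and sets: "sets \<mu> = sets (borel \<Otimes>\<^sub>M borel)" "sets \<nu> = sets (borel \<Otimes>\<^sub>M borel)"
    and eq: "\<And>s t. (CLINT z|\<mu>. iexp (s * fst z + t * snd z)) = (CLINT z|\<nu>. iexp (s * fst z + t * snd z))"
  shows "\<mu> = \<nu>"
proof -
  let ?P = "\<lambda>\<mu>. prob_space \<mu> \<and> sets \<mu> = sets (borel \<Otimes>\<^sub>M (borel :: real measure))"
  define F where "F \<mu> s t = (CLINT z|\<mu>. iexp (s * fst z + t * snd z))" for \<mu> :: "(real \<times> real) measure" and s t
  have Feq: "F \<mu> s t = F \<nu> s t" for s t unfolding F_def by (rule eq)
  have Fint: "complex_integrable \<mu> (\<lambda>z. iexp (s * fst z + t * snd z))" if "?P \<mu>" for \<mu> s t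
  proof -
    interpret prob_space \<mu> using that by simp
    note [measurable_cong] = that[THEN conjunct2]
    show ?thesis by (rule integrable_iexp) auto
  qed
  define W where "W \<mu> w = distr (density \<mu> (\<lambda>z. ennreal (w (snd z)))) borel fst"
    for \<mu> :: "(real \<times> real) measure" and w :: "real \<Rightarrow> real"
  have fin: "finite_measure (W \<mu> w)"
    if "?P \<mu>" and w: "w \<in> borel_measurable borel" "\<And>y. 0 \<le> w y" "\<And>y. w y \<le> 2" for \<mu> w
  proof -
    interpret prob_space \<mu> using that by simp
    note [measurable_cong] = that(1)[THEN conjunct2]
    note [measurable] = w(1)
    have "(\<integral>\<^sup>+z. ennreal (w (snd z)) \<partial>\<mu>) \<le> (\<integral>\<^sup>+z. ennreal 2 \<partial>\<mu>)"
      by (intro nn_integral_mono) (auto intro!: ennreal_leI w simp del: ennreal_numeral)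
    also have "\<dots> = 2" by (simp add: emeasure_space_1)
    finally have "(\<integral>\<^sup>+z. ennreal (w (snd z)) \<partial>\<mu>) \<le> 2" .
    hence "(\<integral>\<^sup>+z. ennreal (w (snd z)) \<partial>\<mu>) < \<infinity>"
      using ennreal_numeral_less_top le_less_trans by (metis infinity_ennreal_def)
    hence "finite_measure (density \<mu> (\<lambda>z. ennreal (w (snd z))))"
      by (intro finite_measureI) (auto simp: emeasure_density cong: nn_integral_cong_simp)
    thus ?thesis unfolding W_def by (rule finite_measure.finite_measure_distr) measurable
  qed
  have charW: "char (W \<mu> w) s = (CLINT z|\<mu>. of_real (w (snd z)) * iexp (s * fst z))"
    if "?P \<mu>" and w: "w \<in> borel_measurable borel" "\<And>y. 0 \<le> w y" for \<mu> w s
  proof -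
    note [measurable_cong] = that(1)[THEN conjunct2]
    note [measurable] = w(1)
    show ?thesis unfolding W_def char_def
      by (subst integral_distr, simp, simp, subst integral_density) (auto simp: w scaleR_conv_of_real)
  qed
  have w: "(\<lambda>y. 1 + cos (t * y + p)) \<in> borel_measurable borel" "0 \<le> 1 + cos (t * y + p)" "1 + cos (t * y + p) \<le> 2"
    for t p y :: real
    using cos_ge_minus_one[of "t * y + p"] cos_le_one[of "t * y + p"] by (auto simp del: cos_ge_minus_one cos_le_one)
  have cosW: "char (W \<mu> (\<lambda>y. 1 + cos (t * y + p))) s = F \<mu> s 0 + (iexp p * F \<mu> s t + iexp (- p) * F \<mu> s (- t)) / 2"
    if "?P \<mu>" for \<mu> s t p
  proof -
    have "char (W \<mu> (\<lambda>y. 1 + cos (t * y + p))) s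
      = (CLINT z|\<mu>. of_real (1 + cos (t * snd z + p)) * iexp (s * fst z))"
      by (rule charW[OF that w(1,2)])
    also have "(\<lambda>z :: real \<times> real. of_real (1 + cos (t * snd z + p)) * iexp (s * fst z))
      = (\<lambda>z. iexp (s * fst z + 0 * snd z)
          + (iexp p * iexp (s * fst z + t * snd z) + iexp (- p) * iexp (s * fst z + (- t) * snd z)) / 2)"
      by (auto simp: fun_eq_iff exp_add[symmetric] algebra_simps exp_diff cos_exp_eq add_divide_distrib simp flip: cos_of_real exp_minus)
    also have "(CLINT z|\<mu>. (iexp (s * fst z + 0 * snd z)
          + (iexp p * iexp (s * fst z + t * snd z) + iexp (- p) * iexp (s * fst z + (- t) * snd z)) / 2))
      = F \<mu> s 0 + (iexp p * F \<mu> s t + iexp (- p) * F \<mu> s (- t)) / 2"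
      unfolding F_def using Fint[OF that, of s 0] Fint[OF that, of s t] Fint[OF that, of s "- t"] by simp
    finally show ?thesis .
  qed
  have Weq: "W \<mu> (\<lambda>y. 1 + cos (t * y + p)) = W \<nu> (\<lambda>y. 1 + cos (t * y + p))" for t p
  proof (rule finite_measure_eqI_char)
    show "finite_measure (W \<mu> (\<lambda>y. 1 + cos (t * y + p)))" "finite_measure (W \<nu> (\<lambda>y. 1 + cos (t * y + p)))"
      using prob sets by (auto intro!: fin w)
    show "char (W \<mu> (\<lambda>y. 1 + cos (t * y + p))) s = char (W \<nu> (\<lambda>y. 1 + cos (t * y + p))) s" for s
      using prob sets Feq by (simp add: cosW)
  qed (simp_all add: W_def)
  \<comment> \<open>Equality of the weighted first marginals is now read with the roles exchanged:
    \<open>A\<close> is held fixed, and varying \<open>t\<close> and \<open>p\<close> gives the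
    trigonometric integrals of the second coordinate over the strip above \<open>A\<close>.\<close>
  define G where "G \<mu> A t p = (LINT z|\<mu>. (1 + cos (t * snd z + p)) * indicator A (fst z))"
    for \<mu> :: "(real \<times> real) measure" and A and t p :: real
  have G: "G \<mu> A t p = G \<nu> A t p" if [measurable]: "A \<in> sets borel" for A t p
  proof -
    have "G \<mu> A t p = (LINT x|W \<mu> (\<lambda>y. 1 + cos (t * y + p)). indicator A x)" if "?P \<mu>" for \<mu>
    proof -
      note [measurable_cong] = that(1)[THEN conjunct2]
      show ?thesis unfolding G_def W_def
        by (subst integral_distr, simp, simp, subst integral_density) (auto simp: w)
    qed
    thus ?thesis using Weq[of t p] prob sets by simp
  qed
  define V where "V \<mu> A = distr (density \<mu> (\<lambda>z. indicator A (fst z))) borel snd"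
    for \<mu> :: "(real \<times> real) measure" and A :: "real set"
  \<comment> \<open>The phases 0 and - pi / 2 yield cosine and sine of \<open>t * snd z\<close>, the
    real and imaginary parts of the wanted integral. Each weight also carries a constant 1, which
    contributes 1 + \<i> times the mass of the strip; at t = p = 0 the weight is constantly 2,
    whence the correction \<open>(1 + \<i>) / 2\<close>.\<close>
  have charV: "char (V \<mu> A) t = G \<mu> A t 0 + \<i> * G \<mu> A t (- pi / 2) - (1 + \<i>) / 2 * G \<mu> A 0 0"
    if "?P \<mu>" and [measurable]: "A \<in> sets borel" for \<mu> A t
  proof -
    interpret prob_space \<mu> using that by simp
    note [measurable_cong] = that(1)[THEN conjunct2]
    have int: "integrable \<mu> (\<lambda>z. (1 + cos (t * snd z + p)) * indicator A (fst z))" for t p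
      by (rule integrable_const_bound[where B = 2]) (use w in \<open>auto split: split_indicator\<close>)
    have "char (V \<mu> A) t = (CLINT z|\<mu>. indicator A (fst z) *\<^sub>R iexp (t * snd z))"
      unfolding V_def char_def
      by (subst integral_distr, simp, simp, subst integral_density[where g = "\<lambda>z. indicator A (fst z)", symmetric])
         (auto simp: ennreal_indicator)
    also have "(\<lambda>z::real \<times> real. indicator A (fst z) *\<^sub>R iexp (t * snd z))
      = (\<lambda>z. of_real ((1 + cos (t * snd z + 0)) * indicator A (fst z))
        + \<i> * of_real ((1 + cos (t * snd z + - pi / 2)) * indicator A (fst z))
        - (1 + \<i>) / 2 * of_real ((1 + cos (0 * snd z + 0)) * indicator A (fst z)))"
      by (auto simp: fun_eq_iff complex_eq_iff Re_exp Im_exp cos_diff split: split_indicator)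
    also have "(CLINT z|\<mu>. (of_real ((1 + cos (t * snd z + 0)) * indicator A (fst z))
        + \<i> * of_real ((1 + cos (t * snd z + - pi / 2)) * indicator A (fst z))
        - (1 + \<i>) / 2 * of_real ((1 + cos (0 * snd z + 0)) * indicator A (fst z))))
      = G \<mu> A t 0 + \<i> * G \<mu> A t (- pi / 2) - (1 + \<i>) / 2 * G \<mu> A 0 0"
      unfolding G_def using int[THEN integrable_of_real[where 'a = complex]]
      by (simp only: Bochner_Integration.integral_add Bochner_Integration.integral_diff
          integral_mult_right_zero Bochner_Integration.integrable_add integrable_mult_right integral_complex_of_real)
    finally show ?thesis .
  qed
  have Vemeasure: "emeasure (V \<mu> A) B = emeasure \<mu> (A \<times> B)"
    if "?P \<mu>" and [measurable]: "A \<in> sets borel" "B \<in> sets borel" for \<mu> A B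
  proof -
    note [measurable_cong] = that(1)[THEN conjunct2]
    have sp: "space \<mu> = UNIV" using sets_eq_imp_space_eq[OF that(1)[THEN conjunct2]] by (simp add: space_pair_measure)
    have "A \<times> B \<in> sets \<mu>" by measurable
    have "emeasure (V \<mu> A) B = emeasure (density \<mu> (\<lambda>z. indicator A (fst z))) (snd -` B)"
      unfolding V_def by (subst emeasure_distr) (auto simp: sp)
    also have "\<dots> = (\<integral>\<^sup>+z. indicator A (fst z) * indicator (snd -` B) z \<partial>\<mu>)"
      using measurable_sets[of snd \<mu> borel B] by (subst emeasure_density) (auto simp: sp)
    also have "\<dots> = (\<integral>\<^sup>+z. indicator (A \<times> B) z \<partial>\<mu>)"
      by (intro nn_integral_cong) (auto split: split_indicator)
    finally have "emeasure (V \<mu> A) B = (\<integral>\<^sup>+z. indicator (A \<times> B) z \<partial>\<mu>)" .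
    thus ?thesis using \<open>A \<times> B \<in> sets \<mu>\<close> by simp
  qed
  have Veq: "V \<mu> A = V \<nu> A" if A: "A \<in> sets borel" for A
  proof (rule finite_measure_eqI_char)
    have "finite_measure (V \<mu> A)" if "?P \<mu>" for \<mu>
    proof (rule finite_measureI)
      interpret prob_space \<mu> using that by simp
      show "emeasure (V \<mu> A) (space (V \<mu> A)) \<noteq> \<infinity>"
        using Vemeasure[OF that A, of UNIV] by (simp add: V_def)
    qed
    thus "finite_measure (V \<mu> A)" "finite_measure (V \<nu> A)" using prob sets by simp_all
    show "char (V \<mu> A) t = char (V \<nu> A) t" for t
      using prob sets G[OF A] by (simp add: charV A)
  qed (simp_all add: V_def)
  let ?E = "{A \<times> B | A B. A \<in> sets (borel :: real measure) \<and> B \<in> sets (borel :: real measure)}"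
  show ?thesis
  proof (rule measure_eqI_generator_eq)
    show "Int_stable ?E" by (rule Int_stable_pair_measure_generator)
    show "?E \<subseteq> Pow UNIV" by simp
    fix X assume "X \<in> ?E"
    then obtain A B where X: "X = A \<times> B" "A \<in> sets borel" "B \<in> sets borel" by blast
    show "emeasure \<mu> X = emeasure \<nu> X"
      using Vemeasure[OF _ X(2,3), of \<mu>] Vemeasure[OF _ X(2,3), of \<nu>] Veq[OF X(2)] prob sets by (simp add: X(1))
  next
    show "sets \<mu> = sigma_sets UNIV ?E" "sets \<nu> = sigma_sets UNIV ?E"
      using sets by (simp_all add: sets_pair_measure)
    show "range (\<lambda>_::nat. UNIV :: (real \<times> real) set) \<subseteq> ?E"
      by (auto intro!: exI[of _ UNIV])
    show "emeasure \<mu> UNIV \<noteq> \<infinity>" using prob(1)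
      by (simp add: finite_measure.emeasure_finite prob_space.finite_measure)
  qed auto
qed

subsection \<open>Sign disagreement of correlated normals\<close>

abbreviation std_normal_pair :: "(real \<times> real) measure"
  where "std_normal_pair \<equiv> std_normal_distribution \<Otimes>\<^sub>M std_normal_distribution"

lemma prob_space_std_normal_pair: "prob_space std_normal_pair"
proof -
  interpret N: prob_space std_normal_distribution by (rule real_distribution.axioms(1)[OF real_dist_normal_dist])
  interpret P: pair_prob_space std_normal_distribution std_normal_distribution ..
  show ?thesis by (rule P.P.prob_space_axioms)
qed

lemma integral_iexp_std_normal_pair:
  "(CLINT z|std_normal_pair. iexp (a * fst z + b * snd z)) = of_real (exp (- (a\<^sup>2 + b\<^sup>2) / 2))"
proof -
  interpret N: prob_space std_normal_distribution by (rule real_distribution.axioms(1)[OF real_dist_normal_dist])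
  interpret P: pair_prob_space std_normal_distribution std_normal_distribution ..
  have ch: "(CLINT x|std_normal_distribution. iexp (t * x)) = of_real (exp (- (t\<^sup>2) / 2))" for t
    using fun_cong[OF char_std_normal_distribution, of t] by (simp add: char_def)
  have "complex_integrable std_normal_pair (\<lambda>z. iexp (a * fst z + b * snd z))"
    by (rule P.P.integrable_iexp) auto
  from P.integral_fst'[OF this]
  have "(CLINT z|std_normal_pair. iexp (a * fst z + b * snd z))
    = (CLINT x|std_normal_distribution. CLINT y|std_normal_distribution. iexp (a * x) * iexp (b * y))"
    by (simp add: exp_add[symmetric] algebra_simps)
  also have "\<dots> = of_real (exp (- (a\<^sup>2) / 2)) * of_real (exp (- (b\<^sup>2) / 2))"
    by (simp only: integral_mult_right_zero integral_mult_left_zero ch)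
  also have "\<dots> = of_real (exp (- (a\<^sup>2 + b\<^sup>2) / 2))"
    by (simp add: exp_add[symmetric] add_divide_distrib flip: of_real_mult)
  finally show ?thesis .
qed

text \<open>The left side is the density at t of the quotient y / x of two independent standard
  normals, with |x| the Jacobian of y = x t. The two exponents combine into that of one normal
  density at q x with q^2 = 1 + t^2, and what remains is the first absolute moment sqrt (2 / pi),
  rescaled by q.\<close>

lemma nn_integral_abs_normal_product:
  "(\<integral>\<^sup>+x. ennreal (\<bar>x\<bar> * std_normal_density x * std_normal_density (x * t)) \<partial>lborel)
    = ennreal (1 / (pi * (1 + t\<^sup>2)))"
proof -
  define q where "q = sqrt (1 + t\<^sup>2)"
  have q: "q > 0" "q\<^sup>2 = 1 + t\<^sup>2" by (auto simp: q_def add_pos_nonneg)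
  let ?I = "\<integral>\<^sup>+x. ennreal (\<bar>x\<bar> * std_normal_density (q * x)) \<partial>lborel"
  have "ennreal (sqrt (2 / pi)) = (\<integral>\<^sup>+x. ennreal (std_normal_density x * \<bar>x\<bar>) \<partial>lborel)"
    using std_normal_moment_abs_odd[of 0] by (subst nn_integral_eq_integral) (auto simp: has_bochner_integral_iff)
  also have "\<dots> = ennreal q * (\<integral>\<^sup>+x. ennreal (std_normal_density (q * x) * \<bar>q * x\<bar>) \<partial>lborel)"
    using q by (subst nn_integral_real_affine[where c = q and t = 0]) auto
  also have "(\<integral>\<^sup>+x. ennreal (std_normal_density (q * x) * \<bar>q * x\<bar>) \<partial>lborel) = ennreal q * ?I"
    using q by (subst nn_integral_cmult[symmetric]) (auto simp: ennreal_mult[symmetric] abs_mult ac_simps)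
  finally have "ennreal (sqrt (2 / pi)) = ennreal (q\<^sup>2) * ?I"
    using q by (simp add: mult.assoc[symmetric] ennreal_mult[symmetric] power2_eq_square)
  hence "ennreal (1 / q\<^sup>2) * ennreal (sqrt (2 / pi)) = ennreal (1 / q\<^sup>2) * ennreal (q\<^sup>2) * ?I"
    by (simp only: mult.assoc)
  moreover have "ennreal (1 / q\<^sup>2) * ennreal (q\<^sup>2) = 1"
    using q(1) by (simp add: ennreal_mult[symmetric])
  moreover have "ennreal (1 / q\<^sup>2) * ennreal (sqrt (2 / pi)) = ennreal (sqrt (2 / pi) / q\<^sup>2)"
    by (simp add: ennreal_mult[symmetric])
  ultimately have I: "?I = ennreal (sqrt (2 / pi) / q\<^sup>2)" by simp
  have "(\<integral>\<^sup>+x. ennreal (\<bar>x\<bar> * std_normal_density x * std_normal_density (x * t)) \<partial>lborel)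
    = (\<integral>\<^sup>+x. ennreal (1 / sqrt (2 * pi)) * ennreal (\<bar>x\<bar> * std_normal_density (q * x)) \<partial>lborel)"
    by (intro nn_integral_cong)
       (simp add: std_normal_density_def ennreal_mult[symmetric] power_mult_distrib q exp_add[symmetric] field_simps)
  also have "\<dots> = ennreal (1 / sqrt (2 * pi) * (sqrt (2 / pi) / q\<^sup>2))"
    by (subst nn_integral_cmult) (auto simp: I ennreal_mult[symmetric])
  also have "1 / sqrt (2 * pi) * (sqrt (2 / pi) / q\<^sup>2) = 1 / (pi * (1 + t\<^sup>2))"
    using q by (simp add: real_sqrt_divide real_sqrt_mult)
  finally show ?thesis .
qed

text \<open>The ratio of the two coordinates has the Cauchy density $1/(\pi(1+t^2))$, and the event is a
  half-line for this ratio.\<close>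

lemma measure_std_normal_pair_sgn_neq:
  fixes c :: real
  assumes c: "0 \<le> c" "c \<le> 1"
  shows "measure std_normal_pair {z. sgn (fst z) \<noteq> sgn (c * fst z + sqrt (1 - c\<^sup>2) * snd z)} = arccos c / pi"
proof (cases "c = 1")
  case False
  \<comment> \<open>For c = 1 the two linear forms coincide and the event is empty. Otherwise s is
    positive, so the threshold c / s below makes sense.\<close>
  define s where "s = sqrt (1 - c\<^sup>2)"
  have s: "s > 0" using c False by (auto simp: s_def power_less_one_iff abs_square_less_1)
  interpret N: prob_space std_normal_distribution by (rule real_distribution.axioms(1)[OF real_dist_normal_dist])
  define E where "E = {z :: real \<times> real. sgn (fst z) \<noteq> sgn (c * fst z + s * snd z)}"
  have "{z \<in> space (borel \<Otimes>\<^sub>M borel). sgn (fst z) \<noteq> sgn (c * fst z + s * snd z)} \<in> sets (borel \<Otimes>\<^sub>M (borel :: real measure))"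
    by measurable
  hence E[measurable]: "E \<in> sets (borel \<Otimes>\<^sub>M borel)" by (simp add: space_pair_measure E_def)
  hence E': "E \<in> sets std_normal_pair" by (simp cong: sets_pair_measure_cong)
  have sect: "(\<lambda>y. indicator E (x, y) :: ennreal) \<in> borel_measurable borel" for x
    by (rule measurable_compose[OF measurable_Pair1' borel_measurable_indicator[OF E]]) simp
  \<comment> \<open>Under y = x t the second linear form becomes x (c + s t). Its sign differs from
    that of x exactly when c + s t is not positive, a condition in which x no longer occurs; the
    value 0 counts as disagreement because x is nonzero.\<close>
  have half: "(\<integral>\<^sup>+y. ennreal (std_normal_density x) * (ennreal (std_normal_density y) * indicator E (x, y)) \<partial>lborel)
    = (\<integral>\<^sup>+t. ennreal (\<bar>x\<bar> * std_normal_density x * std_normal_density (x * t)) * indicator {..- c / s} t \<partial>lborel)"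
    if "x \<noteq> 0" for x
  proof -
    have ind: "indicator E (x, x * t) = (indicator {..- c / s} t :: ennreal)" for t
    proof -
      have "c * x + s * (x * t) = x * (c + s * t)" by (simp add: algebra_simps)
      hence "sgn (c * x + s * (x * t)) = sgn x * sgn (c + s * t)" by (simp add: sgn_mult)
      hence "(x, x * t) \<in> E \<longleftrightarrow> sgn (c + s * t) \<noteq> 1" using that by (auto simp: E_def sgn_0_0)
      also have "\<dots> \<longleftrightarrow> c + s * t \<le> 0" by (simp add: sgn_1_pos not_less)
      also have "\<dots> \<longleftrightarrow> t \<le> - c / s" using pos_le_divide_eq[OF s, of t "- c"] by (auto simp: mult.commute)
      finally show ?thesis by (simp add: indicator_def)
    qed
    let ?f = "\<lambda>y. ennreal (std_normal_density x) * (ennreal (std_normal_density y) * indicator E (x, y))"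
    have f: "?f \<in> borel_measurable borel"
      by (intro borel_measurable_times_ennreal sect measurable_compose[OF _ measurable_ennreal]) simp_all
    have "(\<integral>\<^sup>+y. ?f y \<partial>lborel)
      = ennreal \<bar>x\<bar> * (\<integral>\<^sup>+t. ennreal (std_normal_density x) * (ennreal (std_normal_density (x * t)) * indicator E (x, x * t)) \<partial>lborel)"
      using nn_integral_real_affine[OF f that, of 0] by (simp only: add_0)
    also have "\<dots> = (\<integral>\<^sup>+t. ennreal \<bar>x\<bar> * (ennreal (std_normal_density x) * (ennreal (std_normal_density (x * t)) * indicator {..- c / s} t)) \<partial>lborel)"
      unfolding ind by (rule nn_integral_cmult[symmetric]) measurable
    also have "\<dots> = (\<integral>\<^sup>+t. ennreal (\<bar>x\<bar> * std_normal_density x * std_normal_density (x * t)) * indicator {..- c / s} t \<partial>lborel)"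
      by (simp add: ennreal_mult mult.assoc)
    finally show ?thesis .
  qed
  have "emeasure std_normal_pair E
    = (\<integral>\<^sup>+x. \<integral>\<^sup>+y. indicator E (x, y) \<partial>std_normal_distribution \<partial>std_normal_distribution)"
    by (rule N.emeasure_pair_measure[OF E'])
  also have "\<dots> = (\<integral>\<^sup>+x. \<integral>\<^sup>+y. ennreal (std_normal_density x) * (ennreal (std_normal_density y) * indicator E (x, y)) \<partial>lborel \<partial>lborel)"
  proof -
    have "(\<integral>\<^sup>+y. indicator E (x, y) \<partial>std_normal_distribution)
      = (\<integral>\<^sup>+y. ennreal (std_normal_density y) * indicator E (x, y) \<partial>lborel)" for x
      using sect[of x] by (subst nn_integral_density) simp_all
    moreover have "(\<lambda>x. \<integral>\<^sup>+y. ennreal (std_normal_density y) * indicator E (x, y) \<partial>lborel) \<in> borel_measurable borel"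
      using E by measurable
    ultimately show ?thesis
      using sect by (simp add: nn_integral_density nn_integral_cmult)
  qed
  also have "\<dots> = (\<integral>\<^sup>+x. \<integral>\<^sup>+t. ennreal (\<bar>x\<bar> * std_normal_density x * std_normal_density (x * t)) * indicator {..- c / s} t \<partial>lborel \<partial>lborel)"
    using half by (intro nn_integral_cong_AE AE_I[where N = "{0}"]) auto
  also have "\<dots> = (\<integral>\<^sup>+t. \<integral>\<^sup>+x. ennreal (\<bar>x\<bar> * std_normal_density x * std_normal_density (x * t)) * indicator {..- c / s} t \<partial>lborel \<partial>lborel)"
    by (rule lborel_pair.Fubini'[symmetric]) measurable
  also have "\<dots> = (\<integral>\<^sup>+t. ennreal (1 / (pi * (1 + t\<^sup>2))) * indicator {..- c / s} t \<partial>lborel)"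
    by (simp add: nn_integral_multc nn_integral_abs_normal_product)
  \<comment> \<open>Reflection at 0, since the antiderivative rule applied next integrates over an
    upper half-line.\<close>
  also have "\<dots> = (\<integral>\<^sup>+t. ennreal (1 / (pi * (1 + t\<^sup>2))) * indicator {c / s..} t \<partial>lborel)"
    by (subst nn_integral_real_affine[where c = "- 1" and t = 0])
       (auto intro!: nn_integral_cong split: split_indicator)
  also have "\<dots> = ennreal (1 / 2 - arctan (c / s) / pi)"
  proof (rule nn_integral_FTC_atLeast)
    have "((\<lambda>t. arctan t / pi) \<longlongrightarrow> (pi / 2) / pi) at_top"
      by (intro tendsto_intros tendsto_arctan_at_top) simp
    thus "((\<lambda>t. arctan t / pi) \<longlongrightarrow> 1 / 2) at_top" by simp
  qed (auto intro!: derivative_eq_intros simp: inverse_eq_divide mult.commute)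
  also have "1 / 2 - arctan (c / s) / pi = arccos c / pi"
    using c False by (simp add: arccos_arctan s_def field_simps)
  finally show ?thesis unfolding s_def[symmetric] E_def using c by (simp add: measure_def arccos_lbound)
qed simp

subsection \<open>Expected logarithm of a positive stable variable\<close>

text \<open>The integrand is the integral of exp (- s t) over t between a and b. Exchanging the
  order of integration, which only needs nonnegativity and hence a \<le> b, leaves the integral of 1
  / t.\<close>

lemma nn_integral_frullani_exp:
  fixes a b :: real
  assumes "0 < a" "a \<le> b"
  shows "(\<integral>\<^sup>+s. ennreal ((exp (- (s * a)) - exp (- (s * b))) / s) * indicator {0<..} s \<partial>lborel)
    = ennreal (ln (b / a))"
proof -
  have "(\<integral>\<^sup>+s. ennreal ((exp (- (s * a)) - exp (- (s * b))) / s) * indicator {0<..} s \<partial>lborel)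
    = (\<integral>\<^sup>+s. (\<integral>\<^sup>+t. ennreal (exp (- (s * t))) * indicator {a..b} t * indicator {0<..} s \<partial>lborel) \<partial>lborel)"
  proof (rule nn_integral_cong)
    fix s :: real
    show "ennreal ((exp (- (s * a)) - exp (- (s * b))) / s) * indicator {0<..} s
      = (\<integral>\<^sup>+t. ennreal (exp (- (s * t))) * indicator {a..b} t * indicator {0<..} s \<partial>lborel)"
    proof (cases "s > 0")
      case True
      have "(\<integral>\<^sup>+t. ennreal (exp (- (s * t))) * indicator {a..b} t \<partial>lborel)
        = - exp (- (s * b)) / s - - exp (- (s * a)) / s"
        using True assms
        by (intro nn_integral_FTC_Icc[where F = "\<lambda>t. - exp (- (s * t)) / s"])
           (auto intro!: derivative_eq_intros)
      with True show ?thesis by (simp add: diff_divide_distrib)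
    qed simp
  qed
  also have "\<dots> = (\<integral>\<^sup>+t. (\<integral>\<^sup>+s. ennreal (exp (- (s * t))) * indicator {a..b} t * indicator {0<..} s \<partial>lborel) \<partial>lborel)"
    by (rule lborel_pair.Fubini'[symmetric]) measurable
  also have "\<dots> = (\<integral>\<^sup>+t. ennreal (1 / t) * indicator {a..b} t \<partial>lborel)"
  proof (rule nn_integral_cong)
    fix t :: real
    show "(\<integral>\<^sup>+s. ennreal (exp (- (s * t))) * indicator {a..b} t * indicator {0<..} s \<partial>lborel)
      = ennreal (1 / t) * indicator {a..b} t"
    proof (cases "t \<in> {a..b}")
      case True
      hence t: "t > 0" using assms by auto
      have "(\<integral>\<^sup>+s. ennreal (exp (- (s * t))) * indicator {a..b} t * indicator {0<..} s \<partial>lborel)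
        = (\<integral>\<^sup>+s. ennreal (exp (- (s * t))) * indicator {0..} s \<partial>lborel)"
        using True by (intro nn_integral_cong_AE AE_I[where N = "{0}"]) (auto split: split_indicator)
      also have "\<dots> = ennreal (0 - - exp (- (0 * t)) / t)"
      proof (intro nn_integral_FTC_atLeast[where F = "\<lambda>s. - exp (- (s * t)) / t"])
        have "((\<lambda>s. - exp (- (s * t)) / t) \<longlongrightarrow> - 0 / t) at_top"
          using t by (intro tendsto_intros filterlim_compose[OF exp_at_bot]
            filterlim_compose[OF filterlim_uminus_at_bot_at_top] filterlim_at_top_mult_tendsto_pos[OF tendsto_const])
           (auto simp: filterlim_ident)
        thus "((\<lambda>s. - exp (- (s * t)) / t) \<longlongrightarrow> 0) at_top" by simp
      qed (use t in \<open>auto intro!: derivative_eq_intros\<close>)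
      finally show ?thesis using True by simp
    qed simp
  qed
  also have "\<dots> = ennreal (ln b - ln a)"
    using assms by (intro nn_integral_FTC_Icc[where F = ln]) (auto intro!: derivative_eq_intros simp: field_simps)
  finally show ?thesis using assms by (simp add: ln_div)
qed

text \<open>The integrand has constant sign on the positive half-line, decided by whether x is at
  least 1, so the signed integral reduces to the nonnegative one after a change of sign where
  necessary.\<close>

lemma has_bochner_integral_frullani_exp:
  fixes x :: real
  assumes "0 < x"
  shows "has_bochner_integral lborel (\<lambda>s. (exp (- s) - exp (- (s * x))) / s * indicator {0<..} s) (ln x)"
proof (cases "1 \<le> x")
  case True
  show ?thesis
  proof (rule has_bochner_integral_nn_integral)
    have "(\<integral>\<^sup>+s. ennreal ((exp (- s) - exp (- (s * x))) / s * indicator {0<..} s) \<partial>lborel)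
      = (\<integral>\<^sup>+s. ennreal ((exp (- (s * 1)) - exp (- (s * x))) / s) * indicator {0<..} s \<partial>lborel)"
      by (intro nn_integral_cong) (auto split: split_indicator)
    also have "\<dots> = ennreal (ln (x / 1))" using True by (intro nn_integral_frullani_exp) auto
    finally show "(\<integral>\<^sup>+s. ennreal ((exp (- s) - exp (- (s * x))) / s * indicator {0<..} s) \<partial>lborel) = ennreal (ln x)"
      by simp
  qed (use True in \<open>auto split: split_indicator\<close>)
next
  case False
  have "has_bochner_integral lborel (\<lambda>s. - ((exp (- s) - exp (- (s * x))) / s * indicator {0<..} s)) (- ln x)"
  proof (rule has_bochner_integral_nn_integral)
    have "(\<integral>\<^sup>+s. ennreal (- ((exp (- s) - exp (- (s * x))) / s * indicator {0<..} s)) \<partial>lborel)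
      = (\<integral>\<^sup>+s. ennreal ((exp (- (s * x)) - exp (- (s * 1))) / s) * indicator {0<..} s \<partial>lborel)"
      by (intro nn_integral_cong) (auto split: split_indicator simp: minus_divide_left simp del: minus_divide_left[symmetric])
    also have "\<dots> = ennreal (ln (1 / x))" using False assms by (intro nn_integral_frullani_exp) auto
    finally show "(\<integral>\<^sup>+s. ennreal (- ((exp (- s) - exp (- (s * x))) / s * indicator {0<..} s)) \<partial>lborel) = ennreal (- ln x)"
      using assms by (simp add: ln_div)
  qed (use False assms in \<open>auto split: split_indicator simp: divide_le_0_iff\<close>)
  from has_bochner_integral_minus[OF this] show ?thesis by simp
qed

section \<open>Integrable majorants and a tangent inequality for the arccosine\<close>

lemma integrable_powr_from_0:
  fixes a :: real
  assumes "a > - 1"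
  shows "integrable lborel (\<lambda>s. s powr a * indicator {0<..1} s)"
proof -
  have "(\<lambda>s::real. s powr a) absolutely_integrable_on {0..1}"
    using has_integral_powr_from_0[OF assms, of 1]
    by (intro nonnegative_absolutely_integrable_1) (auto simp: integrable_on_def)
  hence "integrable lebesgue (\<lambda>s. indicator {0..1} s *\<^sub>R s powr a)"
    by (simp add: set_integrable_def)
  hence "integrable lborel (\<lambda>s. indicator {0..1} s *\<^sub>R s powr a)"
    by (subst (asm) integrable_completion) auto
  thus ?thesis
    by (rule Bochner_Integration.integrable_bound) (auto split: split_indicator)
qed

lemma integrable_powr_to_top:
  fixes a :: real
  assumes "a < - 1"
  shows "integrable lborel (\<lambda>s. s powr a * indicator {1..} s)"
proof -
  have "(\<lambda>s::real. s powr a) absolutely_integrable_on {1..}"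
    using has_integral_powr_to_inf[OF assms, of 1]
    by (intro nonnegative_absolutely_integrable_1) (auto simp: integrable_on_def)
  hence "integrable lebesgue (\<lambda>s. indicator {1..} s *\<^sub>R s powr a)"
    by (simp add: set_integrable_def)
  hence "integrable lborel (\<lambda>s. indicator {1..} s *\<^sub>R s powr a)"
    by (subst (asm) integrable_completion) auto
  thus ?thesis
    by (rule Bochner_Integration.integrable_bound) (auto split: split_indicator)
qed

text \<open>The right side is the tangent at ln \<rho> of the function l |-> arccos (exp l), whose
  slope there is - cot (arccos \<rho>). In terms of the angle t = arccos w the claim says that t +
  cot \<psi> ln (cos t) is largest at \<psi> = arccos \<rho>; its derivative 1 - cot \<psi> tan t
  changes from nonnegative to nonpositive there because tan increases.\<close>

lemma arccos_le_ln_tangent: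
  fixes w \<rho> :: real
  assumes "0 < w" "w \<le> 1" "0 < \<rho>" "\<rho> < 1"
  shows "arccos w \<le> arccos \<rho> - cot (arccos \<rho>) * (ln w - ln \<rho>)"
proof -
  define \<phi> where "\<phi> = arccos w"
  define \<psi> where "\<psi> = arccos \<rho>"
  have w: "cos \<phi> = w" and \<rho>: "cos \<psi> = \<rho>" using assms by (auto simp: \<phi>_def \<psi>_def)
  have \<phi>: "0 \<le> \<phi>" "\<phi> < pi / 2"
    using assms arccos_lbound[of w] arccos_less_arccos[of 0 w] by (auto simp: \<phi>_def)
  have \<psi>: "0 < \<psi>" "\<psi> < pi / 2"
    using assms arccos_less_arccos[of \<rho> 1] arccos_less_arccos[of 0 \<rho>] by (auto simp: \<psi>_def)
  define g where "g t = t + cot \<psi> * ln (cos t)" for t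
  have cospos: "cos t > 0" if "0 \<le> t" "t < pi / 2" for t
    using that cos_gt_zero_pi[of t] by auto
  have der: "(g has_real_derivative (1 - cot \<psi> * tan t)) (at t)" if "0 \<le> t" "t < pi / 2" for t
    unfolding g_def using cospos[OF that] by (auto intro!: derivative_eq_intros simp: tan_def)
  have cot: "cot \<psi> = 1 / tan \<psi>" by (simp add: cot_def tan_def)
  have tpos: "tan \<psi> > 0" using \<psi> by (rule tan_gt_zero)
  have "g \<phi> \<le> g \<psi>"
  proof (cases "\<phi> \<le> \<psi>")
    case True
    show ?thesis
    proof (rule DERIV_nonneg_imp_nondecreasing[OF True])
      fix t assume t: "\<phi> \<le> t" "t \<le> \<psi>"
      hence "tan t \<le> tan \<psi>" using \<phi> \<psi> tan_mono_le[of t \<psi>] by auto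
      hence "1 - cot \<psi> * tan t \<ge> 0" using tpos by (simp add: cot field_simps)
      thus "\<exists>y. (g has_real_derivative y) (at t) \<and> 0 \<le> y" using der[of t] t \<phi> \<psi> by force
    qed
  next
    case False
    show ?thesis
    proof (rule DERIV_nonpos_imp_nonincreasing[of \<psi> \<phi>])
      fix t assume t: "\<psi> \<le> t" "t \<le> \<phi>"
      hence "tan \<psi> \<le> tan t" using \<phi> \<psi> tan_mono_le[of \<psi> t] by auto
      hence "1 - cot \<psi> * tan t \<le> 0" using tpos by (simp add: cot field_simps)
      thus "\<exists>y. (g has_real_derivative y) (at t) \<and> y \<le> 0" using der[of t] t \<phi> \<psi> by force
    qed (use False in simp)
  qed
  thus ?thesis unfolding g_def w \<rho> by (simp add: \<phi>_def \<psi>_def algebra_simps)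
qed

text \<open>Both bounds are affine in exp (- b). With b = s X their expectations are therefore given
  by the Laplace transform of X, unlike that of the absolute value. The first bound serves large s,
  the second small s.\<close>

lemma abs_exp_diff_le:
  fixes a b :: real
  assumes "0 \<le> a" "0 \<le> b"
  shows "\<bar>exp (- a) - exp (- b)\<bar> \<le> exp (- a) + exp (- b)"
    and "\<bar>exp (- a) - exp (- b)\<bar> \<le> (1 - exp (- a)) + (1 - exp (- b))"
proof -
  show "\<bar>exp (- a) - exp (- b)\<bar> \<le> exp (- a) + exp (- b)"
    using exp_ge_zero[of "- a"] exp_ge_zero[of "- b"] by (auto simp: abs_if simp del: exp_ge_zero)
  have "exp (- a) \<le> 1" "exp (- b) \<le> 1" using assms by auto
  thus "\<bar>exp (- a) - exp (- b)\<bar> \<le> (1 - exp (- a)) + (1 - exp (- b))" by (auto simp: abs_if)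
qed

lemma exp_minus_le_inverse:
  fixes y :: real
  assumes "0 < y"
  shows "exp (- y) \<le> 1 / y"
proof -
  have "y \<le> exp y" using exp_ge_add_one_self[of y] by linarith
  thus ?thesis using assms by (simp add: exp_minus field_simps)
qed

text \<open>Here \<open>h\<close> is what the two bounds on the difference of exponentials become
  after taking expectations. Near 0 the estimate 1 - exp (- y) \<le> y leaves 1 + s^(\<beta> - 1),
  and beyond 1 the estimate exp (- y) \<le> 1 / y leaves s^(- 2) + s^(- \<beta> - 1); all these
  powers are integrable on their ranges since \<beta> > 0.\<close>

lemma integrable_stable_frullani_bound:
  fixes \<beta> :: real
  assumes \<beta>: "0 < \<beta>"
  defines "h \<equiv> (\<lambda>s. (if s \<le> 1 then (1 - exp (- s)) + (1 - exp (- (s powr \<beta>)))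
      else exp (- s) + exp (- (s powr \<beta>))) / s * indicator {0<..} s)"
  shows "integrable lborel h"
proof (rule Bochner_Integration.integrable_bound)
  let ?H = "\<lambda>s::real. (s powr 0 * indicator {0<..1} s + s powr (\<beta> - 1) * indicator {0<..1} s)
      + (s powr (- 2) * indicator {1..} s + s powr (- \<beta> - 1) * indicator {1..} s)"
  show "integrable lborel ?H"
    using \<beta> by (intro Bochner_Integration.integrable_add integrable_powr_from_0 integrable_powr_to_top) auto
  have "norm (h s) \<le> norm (?H s)" for s
  proof -
    consider "s \<le> 0" | "0 < s" "s \<le> 1" | "1 < s" by linarith
    then show ?thesis
    proof cases
      case 2
      have e: "1 - exp (- y) \<le> y" for y :: real using exp_ge_add_one_self[of "- y"] by linarith
      have "(1 - exp (- s)) + (1 - exp (- (s powr \<beta>))) \<le> s + s powr \<beta>"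
        by (intro add_mono e)
      hence "h s \<le> (s + s powr \<beta>) / s" using 2 by (simp add: h_def divide_right_mono)
      also have "\<dots> = s powr 0 + s powr (\<beta> - 1)" using 2 by (simp add: add_divide_distrib powr_diff)
      also have "\<dots> \<le> ?H s" using 2 by (auto split: split_indicator)
      finally have "h s \<le> ?H s" .
      moreover have "exp (- s) \<le> 1" "exp (- (s powr \<beta>)) \<le> 1" using 2 by simp_all
      hence "0 \<le> (1 - exp (- s)) + (1 - exp (- (s powr \<beta>)))" by linarith
      hence "0 \<le> h s" using 2 by (simp add: h_def)
      ultimately show ?thesis by simp
    next
      case 3
      have "exp (- s) + exp (- (s powr \<beta>)) \<le> 1 / s + 1 / s powr \<beta>"
        using 3 by (intro add_mono exp_minus_le_inverse) auto
      hence "h s \<le> (1 / s + 1 / s powr \<beta>) / s" using 3 by (simp add: h_def divide_right_mono)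
      also have "\<dots> = s powr (- 2) + s powr (- \<beta> - 1)"
      proof -
        have "s powr (- 2) = 1 / s / s"
          using 3 by (simp add: powr_minus_divide power2_eq_square)
        moreover have "s powr (- \<beta> - 1) = 1 / s powr \<beta> / s"
          using 3 by (simp add: powr_diff powr_minus_divide)
        ultimately show ?thesis by (simp add: add_divide_distrib)
      qed
      also have "\<dots> = ?H s" using 3 by simp
      finally show ?thesis using 3 by (simp add: h_def)
    qed (simp add: h_def)
  qed
  thus "AE s in lborel. norm (h s) \<le> norm (?H s)" by simp
qed (simp add: h_def)

text \<open>The expectation of $\ln X$ depends on the law of $X$ only through its Laplace transform, because
  $\ln X = \int_0^\infty (e^{-s} - e^{-sX})\,ds/s$; this replaces uniqueness of Laplace transforms.\<close>

lemma (in prob_space) expectation_ln_stable: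
  fixes X :: "'a \<Rightarrow> real" and \<beta> :: real
  assumes X[measurable]: "X \<in> borel_measurable M" and pos: "\<And>\<omega>. \<omega> \<in> space M \<Longrightarrow> 0 < X \<omega>"
    and \<beta>: "0 < \<beta>"
    and laplace: "\<And>s. 0 \<le> s \<Longrightarrow> expectation (\<lambda>\<omega>. exp (- s * X \<omega>)) = exp (- (s powr \<beta>))"
  shows "integrable M (\<lambda>\<omega>. ln (X \<omega>))"
    and "expectation (\<lambda>\<omega>. ln (X \<omega>))
      = (\<integral>s. (exp (- s) - exp (- (s powr \<beta>))) / s * indicator {0<..} s \<partial>lborel)"
proof -
  interpret L: pair_sigma_finite lborel M ..
  define g where "g = (\<lambda>(s, \<omega>). (exp (- s) - exp (- (s * X \<omega>))) / s * indicator {0<..} (s::real))"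
  have g[measurable]: "g \<in> borel_measurable (lborel \<Otimes>\<^sub>M M)"
    unfolding g_def by measurable
  have iexp: "integrable M (\<lambda>\<omega>. exp (- (s * X \<omega>)))" if "0 \<le> s" for s
    by (rule integrable_const_bound[where B = 1]) (use that pos in \<open>auto intro!: AE_I2 mult_nonneg_nonneg dest!: less_imp_le\<close>)
  have lap: "expectation (\<lambda>\<omega>. exp (- (s * X \<omega>))) = exp (- (s powr \<beta>))" if "0 \<le> s" for s
    using laplace[OF that] by simp
  have ig: "integrable M (\<lambda>\<omega>. g (s, \<omega>))" for s
    using iexp[of s] by (cases "s > 0") (auto simp: g_def)
  \<comment> \<open>No moment of ln X is known beforehand, so joint integrability is obtained in the
    other order: the expectation of |g| at fixed s is bounded through the Laplace transform and then
    integrated over s. Integrability of ln X comes out of Fubini.\<close>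
  have gint: "integrable (lborel \<Otimes>\<^sub>M M) g"
  proof (rule L.Fubini_integrable[OF g])
    show "AE s in lborel. integrable M (\<lambda>\<omega>. g (s, \<omega>))" using ig by simp
    show "integrable lborel (\<lambda>s. \<integral>\<omega>. norm (g (s, \<omega>)) \<partial>M)"
    proof (rule Bochner_Integration.integrable_bound[OF integrable_stable_frullani_bound[OF \<beta>]])
      show "AE s in lborel. norm (\<integral>\<omega>. norm (g (s, \<omega>)) \<partial>M)
        \<le> norm ((if s \<le> 1 then (1 - exp (- s)) + (1 - exp (- (s powr \<beta>)))
          else exp (- s) + exp (- (s powr \<beta>))) / s * indicator {0<..} s)" (is "AE s in lborel. _ \<le> norm (?h s)")
      proof (rule AE_I2)
        fix s :: real
        show "norm (\<integral>\<omega>. norm (g (s, \<omega>)) \<partial>M) \<le> norm (?h s)"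
        proof (cases "s > 0")
          case True
          let ?b = "\<lambda>\<omega>. (if s \<le> 1 then (1 - exp (- s)) + (1 - exp (- (s * X \<omega>)))
            else exp (- s) + exp (- (s * X \<omega>))) / s"
          have "(\<integral>\<omega>. norm (g (s, \<omega>)) \<partial>M) \<le> (\<integral>\<omega>. ?b \<omega> \<partial>M)"
          proof (rule integral_mono)
            show "integrable M (\<lambda>\<omega>. norm (g (s, \<omega>)))" using ig by simp
            show "integrable M ?b" using iexp[of s] True by (cases "s \<le> 1") auto
            show "norm (g (s, \<omega>)) \<le> ?b \<omega>" if "\<omega> \<in> space M" for \<omega>
              using True pos[OF that] abs_exp_diff_le[of s "s * X \<omega>"]
              by (simp add: g_def divide_right_mono)
          qed
          also have "\<dots> = ?h s" using True iexp[of s] lap[of s] by (cases "s \<le> 1") (auto simp: prob_space)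
          also have "\<dots> \<le> norm (?h s)" unfolding real_norm_def by (rule abs_ge_self)
          finally show ?thesis by (subst real_norm_def, subst abs_of_nonneg) auto
        qed (simp add: g_def)
      qed
    qed measurable
  qed
  have inner: "(\<integral>s. g (s, \<omega>) \<partial>lborel) = ln (X \<omega>)" if "\<omega> \<in> space M" for \<omega>
    using has_bochner_integral_integral_eq[OF has_bochner_integral_frullani_exp[OF pos[OF that]]] by (simp add: g_def)
  have "integrable M (\<lambda>\<omega>. \<integral>s. g (s, \<omega>) \<partial>lborel)"
    using L.integrable_snd[of "\<lambda>s \<omega>. g (s, \<omega>)"] gint by (simp add: case_prod_eta)
  thus "integrable M (\<lambda>\<omega>. ln (X \<omega>))"
    by (subst (asm) Bochner_Integration.integrable_cong[OF refl inner]) auto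
  have "expectation (\<lambda>\<omega>. ln (X \<omega>)) = (\<integral>\<omega>. (\<integral>s. g (s, \<omega>) \<partial>lborel) \<partial>M)"
    by (rule Bochner_Integration.integral_cong) (simp_all add: inner)
  also have "\<dots> = (\<integral>s. (\<integral>\<omega>. g (s, \<omega>) \<partial>M) \<partial>lborel)"
    using L.Fubini_integral[of "\<lambda>s \<omega>. g (s, \<omega>)"] gint by (simp add: case_prod_eta)
  also have "\<dots> = (\<integral>s. (exp (- s) - exp (- (s powr \<beta>))) / s * indicator {0<..} s \<partial>lborel)"
  proof (rule Bochner_Integration.integral_cong[OF refl])
    fix s :: real
    show "(\<integral>\<omega>. g (s, \<omega>) \<partial>M) = (exp (- s) - exp (- (s powr \<beta>))) / s * indicator {0<..} s"
      using iexp[of s] lap[of s] by (cases "s > 0") (auto simp: g_def prob_space)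
  qed
  finally show "expectation (\<lambda>\<omega>. ln (X \<omega>))
      = (\<integral>s. (exp (- s) - exp (- (s powr \<beta>))) / s * indicator {0<..} s \<partial>lborel)" .
qed

subsection \<open>Stable linear combinations\<close>

lemma sum_mult_pos:
  fixes c t :: "'i \<Rightarrow> real"
  assumes "finite I" "\<And>i. i \<in> I \<Longrightarrow> 0 \<le> c i" "\<exists>i\<in>I. 0 < c i" "\<And>i. i \<in> I \<Longrightarrow> 0 < t i"
  shows "0 < (\<Sum>i\<in>I. c i * t i)"
proof -
  obtain i where "i \<in> I" "0 < c i" using assms(3) by blast
  thus ?thesis
    using assms by (intro sum_pos2[of I i]) (auto intro!: mult_nonneg_nonneg dest: less_imp_le[OF assms(4)])
qed

context prob_space
begin

lemma expectation_exp_stable_sum: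
  fixes T :: "'i \<Rightarrow> 'a \<Rightarrow> real"
  assumes I: "finite I" and indep: "indep_vars (\<lambda>_. borel) T I"
    and pos: "\<And>i \<omega>. i \<in> I \<Longrightarrow> \<omega> \<in> space M \<Longrightarrow> 0 < T i \<omega>"
    and laplace: "\<And>i s. i \<in> I \<Longrightarrow> 0 \<le> s \<Longrightarrow> expectation (\<lambda>\<omega>. exp (- s * T i \<omega>)) = exp (- (s powr \<beta>))"
    and c: "\<And>i. i \<in> I \<Longrightarrow> 0 \<le> c i" and s: "0 \<le> s"
  shows "expectation (\<lambda>\<omega>. exp (- s * (\<Sum>i\<in>I. c i * T i \<omega>))) = exp (- (s powr \<beta> * (\<Sum>i\<in>I. c i powr \<beta>)))"
proof -
  have [measurable]: "T i \<in> borel_measurable M" if "i \<in> I" for i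
    using indep that by (auto simp: indep_vars_def)
  have "expectation (\<lambda>\<omega>. exp (- s * (\<Sum>i\<in>I. c i * T i \<omega>)))
    = expectation (\<lambda>\<omega>. \<Prod>i\<in>I. exp (- (s * c i) * T i \<omega>))"
    by (simp add: exp_sum[OF I, symmetric] sum_distrib_left sum_negf mult.assoc)
  also have "\<dots> = (\<Prod>i\<in>I. expectation (\<lambda>\<omega>. exp (- (s * c i) * T i \<omega>)))"
  proof (rule indep_vars_lebesgue_integral[OF I])
    show "indep_vars (\<lambda>_. borel) (\<lambda>i \<omega>. exp (- (s * c i) * T i \<omega>)) I"
      by (rule indep_vars_compose2[OF indep, where Y = "\<lambda>i x. exp (- (s * c i) * x)"]) simp
    show "integrable M (\<lambda>\<omega>. exp (- (s * c i) * T i \<omega>))" if "i \<in> I" for i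
    proof (rule integrable_const_bound[where B = 1])
      show "AE \<omega> in M. norm (exp (- (s * c i) * T i \<omega>)) \<le> 1"
        using that s c less_imp_le[OF pos] by (auto intro!: AE_I2 mult_nonneg_nonneg)
    qed (use that in measurable)
  qed
  also have "\<dots> = (\<Prod>i\<in>I. exp (- (s powr \<beta> * c i powr \<beta>)))"
    using s c laplace[of _ "s * c _"] by (intro prod.cong refl) (simp add: powr_mult)
  also have "\<dots> = exp (- (s powr \<beta> * (\<Sum>i\<in>I. c i powr \<beta>)))"
    by (simp add: exp_sum[OF I, symmetric] sum_distrib_left sum_negf)
  finally show ?thesis .
qed

text \<open>Dividing the sum by k = (sum of c_i^\<beta>)^(1 / \<beta>) gives a positive variable
  whose Laplace transform is again exp (- s^\<beta>). The coefficients thus contribute only ln k,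
  and the remaining integral is the same for every choice of c.\<close>

lemma expectation_ln_stable_sum:
  fixes T :: "'i \<Rightarrow> 'a \<Rightarrow> real"
  assumes I: "finite I" and indep: "indep_vars (\<lambda>_. borel) T I"
    and pos: "\<And>i \<omega>. i \<in> I \<Longrightarrow> \<omega> \<in> space M \<Longrightarrow> 0 < T i \<omega>"
    and laplace: "\<And>i s. i \<in> I \<Longrightarrow> 0 \<le> s \<Longrightarrow> expectation (\<lambda>\<omega>. exp (- s * T i \<omega>)) = exp (- (s powr \<beta>))"
    and \<beta>: "0 < \<beta>"
    and c: "\<And>i. i \<in> I \<Longrightarrow> 0 \<le> c i" "\<exists>i\<in>I. 0 < c i"
  shows "integrable M (\<lambda>\<omega>. ln (\<Sum>i\<in>I. c i * T i \<omega>))"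
    and "expectation (\<lambda>\<omega>. ln (\<Sum>i\<in>I. c i * T i \<omega>)) = ln (\<Sum>i\<in>I. c i powr \<beta>) / \<beta>
      + (\<integral>s. (exp (- s) - exp (- (s powr \<beta>))) / s * indicator {0<..} s \<partial>lborel)"
proof -
  have [measurable]: "T i \<in> borel_measurable M" if "i \<in> I" for i
    using indep that by (auto simp: indep_vars_def)
  define K where "K = (\<Sum>i\<in>I. c i powr \<beta>)"
  define k where "k = K powr (1 / \<beta>)"
  have K: "K > 0" unfolding K_def using I c by (auto intro!: sum_pos2)
  hence k: "k > 0" by (simp add: k_def)
  have kK: "(1 / k) powr \<beta> * K = 1"
    using K \<beta> by (simp add: k_def powr_divide powr_powr)
  have S: "(\<Sum>i\<in>I. c i * T i \<omega>) > 0" if \<omega>: "\<omega> \<in> space M" for \<omega>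
    by (rule sum_mult_pos[OF I c pos[OF _ \<omega>]])
  define X where "X \<omega> = (\<Sum>i\<in>I. c i * T i \<omega>) / k" for \<omega>
  have "X \<in> borel_measurable M" unfolding X_def by measurable
  moreover have "X \<omega> > 0" if "\<omega> \<in> space M" for \<omega> using S[OF that] k by (simp add: X_def)
  moreover have "expectation (\<lambda>\<omega>. exp (- s * X \<omega>)) = exp (- (s powr \<beta>))" if "0 \<le> s" for s
  proof -
    have "expectation (\<lambda>\<omega>. exp (- s * X \<omega>))
      = expectation (\<lambda>\<omega>. exp (- (s * (1 / k)) * (\<Sum>i\<in>I. c i * T i \<omega>)))"
      by (simp add: X_def)
    also have "\<dots> = exp (- ((s * (1 / k)) powr \<beta> * K))"
      unfolding K_def using that k by (intro expectation_exp_stable_sum I indep pos laplace c(1)) auto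
    also have "(s * (1 / k)) powr \<beta> * K = s powr \<beta> * ((1 / k) powr \<beta> * K)"
      using that k by (subst powr_mult) auto
    finally show ?thesis by (simp add: kK)
  qed
  ultimately have X: "integrable M (\<lambda>\<omega>. ln (X \<omega>))"
    "expectation (\<lambda>\<omega>. ln (X \<omega>)) = (\<integral>s. (exp (- s) - exp (- (s powr \<beta>))) / s * indicator {0<..} s \<partial>lborel)"
    using \<beta> by (blast intro: expectation_ln_stable)+
  have ln: "ln (\<Sum>i\<in>I. c i * T i \<omega>) = ln (X \<omega>) + ln K / \<beta>" if "\<omega> \<in> space M" for \<omega>
    using S[OF that] k K by (simp add: X_def ln_div) (simp add: k_def ln_powr)
  show "integrable M (\<lambda>\<omega>. ln (\<Sum>i\<in>I. c i * T i \<omega>))"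
    using X(1) by (subst Bochner_Integration.integrable_cong[OF refl ln]) auto
  show "expectation (\<lambda>\<omega>. ln (\<Sum>i\<in>I. c i * T i \<omega>)) = ln (\<Sum>i\<in>I. c i powr \<beta>) / \<beta>
      + (\<integral>s. (exp (- s) - exp (- (s powr \<beta>))) / s * indicator {0<..} s \<partial>lborel)"
    using X by (subst Bochner_Integration.integral_cong[OF refl ln]) (auto simp: prob_space K_def)
qed

text \<open>Taken with w_i = s u_i + t v_i this is the joint characteristic function of (x, y) at
  (s, t). Such weights can be negative, hence the absolute values.\<close>

lemma char_stable_sum:
  fixes r :: "'i \<Rightarrow> 'a \<Rightarrow> real"
  assumes I: "finite I" and indep: "indep_vars (\<lambda>_. borel) r I"
    and char: "\<And>i t. i \<in> I \<Longrightarrow> char (distr M borel (r i)) t = of_real (exp (- (\<bar>t\<bar> powr \<alpha>)))"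
  shows "(CLINT \<omega>|M. iexp (\<Sum>i\<in>I. w i * r i \<omega>)) = of_real (exp (- (\<Sum>i\<in>I. \<bar>w i\<bar> powr \<alpha>)))"
proof -
  have [measurable]: "r i \<in> borel_measurable M" if "i \<in> I" for i
    using indep that by (auto simp: indep_vars_def)
  have "(CLINT \<omega>|M. iexp (\<Sum>i\<in>I. w i * r i \<omega>)) = (CLINT \<omega>|M. (\<Prod>i\<in>I. iexp (w i * r i \<omega>)))"
    by (simp add: exp_sum[OF I, symmetric] sum_distrib_left)
  also have "\<dots> = (\<Prod>i\<in>I. (CLINT \<omega>|M. iexp (w i * r i \<omega>)))"
  proof (rule indep_vars_lebesgue_integral[OF I])
    show "indep_vars (\<lambda>_. borel) (\<lambda>i \<omega>. iexp (w i * r i \<omega>)) I"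
      by (rule indep_vars_compose2[OF indep, where Y = "\<lambda>i x. iexp (w i * x)"]) simp
    show "complex_integrable M (\<lambda>\<omega>. iexp (w i * r i \<omega>))" if "i \<in> I" for i
      by (rule integrable_iexp) (use that in auto)
  qed
  also have "\<dots> = (\<Prod>i\<in>I. of_real (exp (- (\<bar>w i\<bar> powr \<alpha>))))"
  proof (rule prod.cong[OF refl])
    fix i assume i: "i \<in> I"
    show "(CLINT \<omega>|M. iexp (w i * r i \<omega>)) = of_real (exp (- (\<bar>w i\<bar> powr \<alpha>)))"
      using char[OF i, of "w i"] i by (simp add: char_def integral_distr)
  qed
  also have "\<dots> = of_real (exp (- (\<Sum>i\<in>I. \<bar>w i\<bar> powr \<alpha>)))"
    by (simp add: exp_sum[OF I, symmetric] sum_negf flip: of_real_prod)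
  finally show ?thesis .
qed

end

section \<open>The sign probability as an expected angle, and its bound\<close>

text \<open>Cauchy-Schwarz for the vectors with entries u_i sqrt T_i and v_i sqrt T_i: the quotient
  is the cosine of their angle. A zero denominator is harmless, as the quotient is then 0.\<close>

lemma sum_weighted_cos_bounds:
  fixes u v T :: "'i \<Rightarrow> real"
  assumes "finite I" and "\<And>i. i \<in> I \<Longrightarrow> 0 \<le> u i" "\<And>i. i \<in> I \<Longrightarrow> 0 \<le> v i" "\<And>i. i \<in> I \<Longrightarrow> 0 < T i"
  shows "0 \<le> (\<Sum>i\<in>I. u i * v i * T i) / sqrt ((\<Sum>i\<in>I. (u i)\<^sup>2 * T i) * (\<Sum>i\<in>I. (v i)\<^sup>2 * T i))"
    and "(\<Sum>i\<in>I. u i * v i * T i) / sqrt ((\<Sum>i\<in>I. (u i)\<^sup>2 * T i) * (\<Sum>i\<in>I. (v i)\<^sup>2 * T i)) \<le> 1"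
proof -
  have T: "0 \<le> T i" if "i \<in> I" for i using assms(4)[OF that] by simp
  have "0 \<le> (\<Sum>i\<in>I. (u i)\<^sup>2 * T i) * (\<Sum>i\<in>I. (v i)\<^sup>2 * T i)"
    by (intro mult_nonneg_nonneg sum_nonneg) (auto simp: T)
  thus "0 \<le> (\<Sum>i\<in>I. u i * v i * T i) / sqrt ((\<Sum>i\<in>I. (u i)\<^sup>2 * T i) * (\<Sum>i\<in>I. (v i)\<^sup>2 * T i))"
    by (intro divide_nonneg_nonneg sum_nonneg mult_nonneg_nonneg) (auto simp: assms T)
  have "(\<Sum>i\<in>I. u i * v i * T i) = (\<Sum>i\<in>I. \<bar>u i * sqrt (T i)\<bar> * \<bar>v i * sqrt (T i)\<bar>)"
    using assms T by (intro sum.cong) (auto simp: abs_mult algebra_simps)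
  also have "\<dots> \<le> L2_set (\<lambda>i. u i * sqrt (T i)) I * L2_set (\<lambda>i. v i * sqrt (T i)) I"
    by (rule L2_set_mult_ineq)
  also have "\<dots> = sqrt ((\<Sum>i\<in>I. (u i)\<^sup>2 * T i) * (\<Sum>i\<in>I. (v i)\<^sup>2 * T i))"
    using T by (simp add: L2_set_def power_mult_distrib real_sqrt_mult cong: sum.cong)
  finally have le: "(\<Sum>i\<in>I. u i * v i * T i) \<le> sqrt ((\<Sum>i\<in>I. (u i)\<^sup>2 * T i) * (\<Sum>i\<in>I. (v i)\<^sup>2 * T i))" .
  show "(\<Sum>i\<in>I. u i * v i * T i) / sqrt ((\<Sum>i\<in>I. (u i)\<^sup>2 * T i) * (\<Sum>i\<in>I. (v i)\<^sup>2 * T i)) \<le> 1"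
  proof (cases "sqrt ((\<Sum>i\<in>I. (u i)\<^sup>2 * T i) * (\<Sum>i\<in>I. (v i)\<^sup>2 * T i)) = 0")
    case False
    hence "0 < sqrt ((\<Sum>i\<in>I. (u i)\<^sup>2 * T i) * (\<Sum>i\<in>I. (v i)\<^sup>2 * T i))"
      using \<open>0 \<le> (\<Sum>i\<in>I. (u i)\<^sup>2 * T i) * (\<Sum>i\<in>I. (v i)\<^sup>2 * T i)\<close>
      by (metis less_eq_real_def real_sqrt_ge_zero)
    thus ?thesis using le by (simp only: divide_le_eq_1_pos)
  qed (simp only: div_by_0 zero_le_one)
qed

text \<open>Given $T$, the vector $(\sum_i u_i \sqrt{2T_i} Z_i, \sum_i v_i \sqrt{2T_i} Z_i)$ with independent standard
  normal $Z_i$ is a planar Gaussian, realised here by just two standard normals. Its mixture over $T$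
  has the characteristic function of $(x, y)$, so only the law of the pair is needed and not that
  of the individual $r_i$.\<close>

lemma (in prob_space) prob_sgn_neq_stable_sums:
  fixes r T :: "'i \<Rightarrow> 'a \<Rightarrow> real" and u v :: "'i \<Rightarrow> real"
  assumes I: "finite I"
    and u: "\<And>i. i \<in> I \<Longrightarrow> 0 \<le> u i" "\<exists>i\<in>I. 0 < u i" and v: "\<And>i. i \<in> I \<Longrightarrow> 0 \<le> v i" "\<exists>i\<in>I. 0 < v i"
    and r_indep: "indep_vars (\<lambda>_. borel) r I"
    and r_char: "\<And>i t. i \<in> I \<Longrightarrow> char (distr M borel (r i)) t = of_real (exp (- (\<bar>t\<bar> powr \<alpha>)))"
    and T_indep: "indep_vars (\<lambda>_. borel) T I"
    and T_pos: "\<And>i \<omega>. i \<in> I \<Longrightarrow> \<omega> \<in> space M \<Longrightarrow> 0 < T i \<omega>"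
    and T_laplace: "\<And>i s. i \<in> I \<Longrightarrow> 0 \<le> s \<Longrightarrow> expectation (\<lambda>\<omega>. exp (- s * T i \<omega>)) = exp (- (s powr (\<alpha> / 2)))"
  shows "prob {\<omega> \<in> space M. sgn (\<Sum>i\<in>I. u i * r i \<omega>) \<noteq> sgn (\<Sum>i\<in>I. v i * r i \<omega>)}
    = expectation (\<lambda>\<omega>. arccos ((\<Sum>i\<in>I. u i * v i * T i \<omega>)
        / sqrt ((\<Sum>i\<in>I. (u i)\<^sup>2 * T i \<omega>) * (\<Sum>i\<in>I. (v i)\<^sup>2 * T i \<omega>))) / pi)"
proof -
  interpret P: prob_space std_normal_pair by (rule prob_space_std_normal_pair)
  interpret Q: pair_prob_space M std_normal_pair ..
  let ?Q = "M \<Otimes>\<^sub>M std_normal_pair"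
  have [measurable]: "T i \<in> borel_measurable M" if "i \<in> I" for i
    using T_indep that by (auto simp: indep_vars_def)
  have [measurable]: "r i \<in> borel_measurable M" if "i \<in> I" for i
    using r_indep that by (auto simp: indep_vars_def)
  define Suu where "Suu \<omega> = (\<Sum>i\<in>I. (u i)\<^sup>2 * T i \<omega>)" for \<omega>
  define Svv where "Svv \<omega> = (\<Sum>i\<in>I. (v i)\<^sup>2 * T i \<omega>)" for \<omega>
  define Suv where "Suv \<omega> = (\<Sum>i\<in>I. u i * v i * T i \<omega>)" for \<omega>
  define c where "c \<omega> = Suv \<omega> / sqrt (Suu \<omega> * Svv \<omega>)" for \<omega>
  have [measurable]: "Suu \<in> borel_measurable M" "Svv \<in> borel_measurable M" "Suv \<in> borel_measurable M"
    unfolding Suu_def Svv_def Suv_def by measurable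
  have [measurable]: "c \<in> borel_measurable M" unfolding c_def by measurable
  have pos: "0 < (\<Sum>i\<in>I. (w i)\<^sup>2 * T i \<omega>)" if w: "\<exists>i\<in>I. 0 < w i" and \<omega>: "\<omega> \<in> space M" for w :: "'i \<Rightarrow> real" and \<omega>
    using w by (intro sum_mult_pos I T_pos[OF _ \<omega>]) (simp, force)
  have Suu: "0 < Suu \<omega>" and Svv: "0 < Svv \<omega>" if "\<omega> \<in> space M" for \<omega>
    using pos[OF u(2) that] pos[OF v(2) that] by (simp_all add: Suu_def Svv_def)
  have c: "0 \<le> c \<omega>" "c \<omega> \<le> 1" if "\<omega> \<in> space M" for \<omega>
    unfolding c_def Suu_def Svv_def Suv_def
    by (rule sum_weighted_cos_bounds[OF I u(1) v(1) T_pos[OF _ that]]; assumption)+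
  define x where "x \<omega> = (\<Sum>i\<in>I. u i * r i \<omega>)" for \<omega>
  define y where "y \<omega> = (\<Sum>i\<in>I. v i * r i \<omega>)" for \<omega>
  have [measurable]: "x \<in> borel_measurable M" "y \<in> borel_measurable M"
    unfolding x_def y_def by measurable
  \<comment> \<open>Given \<omega>, the pair (X, Y) is centred Gaussian with variances 2 Suu and 2
    Svv and covariance 2 Suv: \<open>c\<close> is the correlation, and 1, c, sqrt (1 - c^2) are the
    entries of the Cholesky factor of the correlation matrix.\<close>
  define X where "X q = sqrt (2 * Suu (fst q)) * fst (snd q)" for q :: "'a \<times> real \<times> real"
  define Y where "Y q = sqrt (2 * Svv (fst q)) * (c (fst q) * fst (snd q) + sqrt (1 - (c (fst q))\<^sup>2) * snd (snd q))"
    for q :: "'a \<times> real \<times> real"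
  have [measurable]: "X \<in> borel_measurable ?Q" "Y \<in> borel_measurable ?Q"
    unfolding X_def Y_def by measurable
  have cfxy: "(CLINT \<omega>|M. iexp (s * x \<omega> + t * y \<omega>)) = of_real (exp (- (\<Sum>i\<in>I. \<bar>s * u i + t * v i\<bar> powr \<alpha>)))" for s t
  proof -
    have "s * x \<omega> + t * y \<omega> = (\<Sum>i\<in>I. (s * u i + t * v i) * r i \<omega>)" for \<omega>
      unfolding x_def y_def by (simp add: sum_distrib_left sum.distrib[symmetric] algebra_simps)
    thus ?thesis using char_stable_sum[OF I r_indep r_char, of "\<lambda>i. s * u i + t * v i"] by (simp only:)
  qed
  \<comment> \<open>The quadratic form of the covariance matrix is rewritten as one sum over i. The
    factor \<open>- 1\<close> stays visible so that integrating over \<omega> is an evaluation of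
    the Laplace transform at 1.\<close>
  have inner: "(CLINT z|std_normal_pair. iexp (s * X (\<omega>, z) + t * Y (\<omega>, z)))
      = of_real (exp (- 1 * (\<Sum>i\<in>I. (s * u i + t * v i)\<^sup>2 * T i \<omega>)))" if \<omega>: "\<omega> \<in> space M" for s t \<omega>
  proof -
    let ?a = "sqrt (2 * Suu \<omega>)" and ?b = "sqrt (2 * Svv \<omega>)" and ?c = "c \<omega>"
    let ?p = "s * ?a + t * ?b * ?c" and ?q = "t * ?b * sqrt (1 - ?c\<^sup>2)"
    have "(CLINT z|std_normal_pair. iexp (s * X (\<omega>, z) + t * Y (\<omega>, z)))
      = (CLINT z|std_normal_pair. iexp (?p * fst z + ?q * snd z))"
      by (simp only: X_def Y_def fst_conv snd_conv) (simp add: algebra_simps)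
    also have "\<dots> = of_real (exp (- (?p\<^sup>2 + ?q\<^sup>2) / 2))"
      by (rule integral_iexp_std_normal_pair)
    also have "?p\<^sup>2 + ?q\<^sup>2 = 2 * (\<Sum>i\<in>I. (s * u i + t * v i)\<^sup>2 * T i \<omega>)"
    proof -
      have "?c\<^sup>2 \<le> 1" using c[OF \<omega>] by (simp add: power_le_one)
      hence q: "(sqrt (1 - ?c\<^sup>2))\<^sup>2 = 1 - ?c\<^sup>2" by simp
      have ab: "?a\<^sup>2 = 2 * Suu \<omega>" "?b\<^sup>2 = 2 * Svv \<omega>" using Suu[OF \<omega>] Svv[OF \<omega>] by simp_all
      have "?a * ?b = 2 * sqrt (Suu \<omega> * Svv \<omega>)" by (simp add: real_sqrt_mult)
      hence abc: "?a * ?b * ?c = 2 * Suv \<omega>"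
        using Suu[OF \<omega>] Svv[OF \<omega>] by (simp add: c_def)
      have "?p\<^sup>2 + ?q\<^sup>2 = s\<^sup>2 * ?a\<^sup>2 + 2 * s * t * (?a * ?b * ?c) + t\<^sup>2 * ?b\<^sup>2 * ?c\<^sup>2 + t\<^sup>2 * ?b\<^sup>2 * (sqrt (1 - ?c\<^sup>2))\<^sup>2"
        by (simp only: power2_eq_square) (simp only: algebra_simps)
      also have "\<dots> = 2 * (s\<^sup>2 * Suu \<omega> + 2 * s * t * Suv \<omega> + t\<^sup>2 * Svv \<omega>)"
        unfolding q ab abc by (simp add: algebra_simps)
      also have "s\<^sup>2 * Suu \<omega> + 2 * s * t * Suv \<omega> + t\<^sup>2 * Svv \<omega> = (\<Sum>i\<in>I. (s * u i + t * v i)\<^sup>2 * T i \<omega>)"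
        unfolding Suu_def Svv_def Suv_def
        by (simp add: sum_distrib_left sum.distrib[symmetric] power2_eq_square algebra_simps)
      finally show ?thesis .
    qed
    finally show ?thesis by simp
  qed
  have cfXY: "(CLINT q|?Q. iexp (s * X q + t * Y q)) = of_real (exp (- (\<Sum>i\<in>I. \<bar>s * u i + t * v i\<bar> powr \<alpha>)))" for s t
  proof -
    have "complex_integrable ?Q (\<lambda>q. iexp (s * X q + t * Y q))"
      by (rule Q.P.integrable_iexp) auto
    from Q.integral_fst'[OF this]
    have "(CLINT q|?Q. iexp (s * X q + t * Y q))
      = (CLINT \<omega>|M. (CLINT z|std_normal_pair. iexp (s * X (\<omega>, z) + t * Y (\<omega>, z))))" by simp
    also have "\<dots> = (CLINT \<omega>|M. of_real (exp (- 1 * (\<Sum>i\<in>I. (s * u i + t * v i)\<^sup>2 * T i \<omega>))))"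
      by (rule Bochner_Integration.integral_cong[OF refl inner])
    also have "\<dots> = of_real (expectation (\<lambda>\<omega>. exp (- 1 * (\<Sum>i\<in>I. (s * u i + t * v i)\<^sup>2 * T i \<omega>))))"
      by (rule integral_complex_of_real)
    also have "expectation (\<lambda>\<omega>. exp (- 1 * (\<Sum>i\<in>I. (s * u i + t * v i)\<^sup>2 * T i \<omega>)))
      = exp (- (1 powr (\<alpha> / 2) * (\<Sum>i\<in>I. ((s * u i + t * v i)\<^sup>2) powr (\<alpha> / 2))))"
      by (rule expectation_exp_stable_sum[OF I T_indep T_pos T_laplace]) auto
    also have "(\<Sum>i\<in>I. ((s * u i + t * v i)\<^sup>2) powr (\<alpha> / 2)) = (\<Sum>i\<in>I. \<bar>s * u i + t * v i\<bar> powr \<alpha>)"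
      by (intro sum.cong refl) (metis abs_ge_zero mult_2 field_sum_of_halves power2_abs powr_add power2_eq_square powr_mult)
    finally show ?thesis by simp
  qed
  have law: "distr M (borel \<Otimes>\<^sub>M borel) (\<lambda>\<omega>. (x \<omega>, y \<omega>)) = distr ?Q (borel \<Otimes>\<^sub>M borel) (\<lambda>q. (X q, Y q))"
  proof (rule Levy_uniqueness_pair)
    show "prob_space (distr M (borel \<Otimes>\<^sub>M borel) (\<lambda>\<omega>. (x \<omega>, y \<omega>)))"
      by (rule prob_space_distr) measurable
    show "prob_space (distr ?Q (borel \<Otimes>\<^sub>M borel) (\<lambda>q. (X q, Y q)))"
      by (rule Q.P.prob_space_distr) measurable
    fix s t :: real
    have "(CLINT z|distr M (borel \<Otimes>\<^sub>M borel) (\<lambda>\<omega>. (x \<omega>, y \<omega>)). iexp (s * fst z + t * snd z))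
      = (CLINT \<omega>|M. iexp (s * x \<omega> + t * y \<omega>))"
      by (subst integral_distr) simp_all
    moreover have "(CLINT z|distr ?Q (borel \<Otimes>\<^sub>M borel) (\<lambda>q. (X q, Y q)). iexp (s * fst z + t * snd z))
      = (CLINT q|?Q. iexp (s * X q + t * Y q))"
      by (subst integral_distr) simp_all
    ultimately show "(CLINT z|distr M (borel \<Otimes>\<^sub>M borel) (\<lambda>\<omega>. (x \<omega>, y \<omega>)). iexp (s * fst z + t * snd z))
      = (CLINT z|distr ?Q (borel \<Otimes>\<^sub>M borel) (\<lambda>q. (X q, Y q)). iexp (s * fst z + t * snd z))"
      by (simp only: cfxy cfXY)
  qed simp_all
  have *: "{z \<in> space (borel \<Otimes>\<^sub>M borel). sgn (fst z) \<noteq> sgn (snd z)} \<in> sets (borel \<Otimes>\<^sub>M (borel :: real measure))"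
    by measurable
  define E where "E = {z :: real \<times> real. sgn (fst z) \<noteq> sgn (snd z)}"
  have E[measurable]: "E \<in> sets (borel \<Otimes>\<^sub>M borel)" using * by (simp add: space_pair_measure E_def)
  have "prob {\<omega> \<in> space M. sgn (x \<omega>) \<noteq> sgn (y \<omega>)} = measure (distr M (borel \<Otimes>\<^sub>M borel) (\<lambda>\<omega>. (x \<omega>, y \<omega>))) E"
  proof -
    have "(\<lambda>\<omega>. (x \<omega>, y \<omega>)) -` E \<inter> space M = {\<omega> \<in> space M. sgn (x \<omega>) \<noteq> sgn (y \<omega>)}"
      by (auto simp: E_def)
    thus ?thesis by (simp add: measure_distr)
  qed
  also have "\<dots> = (LINT z|distr ?Q (borel \<Otimes>\<^sub>M borel) (\<lambda>q. (X q, Y q)). indicator E z)"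
    unfolding law by simp
  also have "\<dots> = (LINT q|?Q. indicator E (X q, Y q))"
    by (subst integral_distr) simp_all
  also have "\<dots> = (LINT \<omega>|M. (LINT z|std_normal_pair. indicator E (X (\<omega>, z), Y (\<omega>, z))))"
  proof (rule Q.integral_fst'[symmetric])
    show "integrable ?Q (\<lambda>q. indicator E (X q, Y q) :: real)"
      by (rule Q.P.integrable_const_bound[where B = 1]) (auto split: split_indicator)
  qed
  also have "\<dots> = (LINT \<omega>|M. arccos (c \<omega>) / pi)"
  proof (rule Bochner_Integration.integral_cong[OF refl])
    fix \<omega> assume \<omega>: "\<omega> \<in> space M"
    \<comment> \<open>The scale factors sqrt (2 Suu) and sqrt (2 Svv) are positive and do not affect
      signs, so only the correlation matters.\<close>
    let ?F = "{z. sgn (fst z) \<noteq> sgn (c \<omega> * fst z + sqrt (1 - (c \<omega>)\<^sup>2) * snd z)}"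
    have "(LINT z|std_normal_pair. indicator E (X (\<omega>, z), Y (\<omega>, z))) = (LINT z|std_normal_pair. indicator ?F z :: real)"
      using Suu[OF \<omega>] Svv[OF \<omega>]
      by (intro Bochner_Integration.integral_cong) (auto simp: X_def Y_def sgn_mult indicator_def E_def)
    also have "\<dots> = measure std_normal_pair ?F" by (simp add: space_pair_measure)
    also have "\<dots> = arccos (c \<omega>) / pi" by (rule measure_std_normal_pair_sgn_neq[OF c[OF \<omega>]])
    finally show "(LINT z|std_normal_pair. indicator E (X (\<omega>, z), Y (\<omega>, z))) = arccos (c \<omega>) / pi" .
  qed
  finally show ?thesis unfolding x_def y_def c_def Suu_def Svv_def Suv_def .
qed

text \<open>Jensen's inequality is carried out by integrating the tangent inequality at the point ln
  \<rho>. This point is the mean of ln W, so the linear term integrates to 0.\<close>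

lemma (in prob_space) expectation_arccos_stable_le:
  fixes T :: "'i \<Rightarrow> 'a \<Rightarrow> real" and u v :: "'i \<Rightarrow> real"
  assumes I: "finite I" and \<alpha>: "0 < \<alpha>"
    and u: "\<And>i. i \<in> I \<Longrightarrow> 0 \<le> u i" "\<exists>i\<in>I. 0 < u i" and v: "\<And>i. i \<in> I \<Longrightarrow> 0 \<le> v i" "\<exists>i\<in>I. 0 < v i"
    and T_indep: "indep_vars (\<lambda>_. borel) T I"
    and T_pos: "\<And>i \<omega>. i \<in> I \<Longrightarrow> \<omega> \<in> space M \<Longrightarrow> 0 < T i \<omega>"
    and T_laplace: "\<And>i s. i \<in> I \<Longrightarrow> 0 \<le> s \<Longrightarrow> expectation (\<lambda>\<omega>. exp (- s * T i \<omega>)) = exp (- (s powr (\<alpha> / 2)))"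
  defines "\<rho> \<equiv> ((\<Sum>i\<in>I. u i powr (\<alpha> / 2) * v i powr (\<alpha> / 2))
              / sqrt ((\<Sum>i\<in>I. u i powr \<alpha>) * (\<Sum>i\<in>I. v i powr \<alpha>))) powr (2 / \<alpha>)"
  shows "expectation (\<lambda>\<omega>. arccos ((\<Sum>i\<in>I. u i * v i * T i \<omega>)
        / sqrt ((\<Sum>i\<in>I. (u i)\<^sup>2 * T i \<omega>) * (\<Sum>i\<in>I. (v i)\<^sup>2 * T i \<omega>)))) \<le> arccos \<rho>"
proof -
  have [measurable]: "T i \<in> borel_measurable M" if "i \<in> I" for i
    using T_indep that by (auto simp: indep_vars_def)
  define Suu where "Suu \<omega> = (\<Sum>i\<in>I. (u i)\<^sup>2 * T i \<omega>)" for \<omega>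
  define Svv where "Svv \<omega> = (\<Sum>i\<in>I. (v i)\<^sup>2 * T i \<omega>)" for \<omega>
  define Suv where "Suv \<omega> = (\<Sum>i\<in>I. u i * v i * T i \<omega>)" for \<omega>
  define W where "W \<omega> = Suv \<omega> / sqrt (Suu \<omega> * Svv \<omega>)" for \<omega>
  have [measurable]: "Suu \<in> borel_measurable M" "Svv \<in> borel_measurable M" "Suv \<in> borel_measurable M"
    unfolding Suu_def Svv_def Suv_def by measurable
  have [measurable]: "W \<in> borel_measurable M" unfolding W_def by measurable
  have W: "0 \<le> W \<omega>" "W \<omega> \<le> 1" if "\<omega> \<in> space M" for \<omega>
    unfolding W_def Suu_def Svv_def Suv_def
    by (rule sum_weighted_cos_bounds[OF I u(1) v(1) T_pos[OF _ that]]; assumption)+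
  have uu: "\<exists>i\<in>I. 0 < (u i)\<^sup>2" and vv: "\<exists>i\<in>I. 0 < (v i)\<^sup>2"
    using u(2) v(2) by force+
  have Suu: "0 < Suu \<omega>" and Svv: "0 < Svv \<omega>" if "\<omega> \<in> space M" for \<omega>
    unfolding Suu_def Svv_def by (rule sum_mult_pos[OF I _ uu T_pos[OF _ that]] sum_mult_pos[OF I _ vv T_pos[OF _ that]]; simp)+
  have "expectation (\<lambda>\<omega>. arccos (W \<omega>)) \<le> arccos \<rho>"
  proof (cases "\<exists>i\<in>I. 0 < u i * v i")
    \<comment> \<open>With disjoint supports both W and \<rho> are 0, the latter because
      \<open>0 powr a = 0\<close>, and the bound is an equality of right angles.\<close>
    case False
    hence uv: "u i * v i = 0" if "i \<in> I" for i
      using that u(1) v(1) by (metis less_eq_real_def mult_nonneg_nonneg)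
    have "Suv \<omega> = 0" for \<omega> unfolding Suv_def using uv by (intro sum.neutral) auto
    moreover have "(\<Sum>i\<in>I. u i powr (\<alpha> / 2) * v i powr (\<alpha> / 2)) = 0"
      using uv by (intro sum.neutral) auto
    ultimately show ?thesis by (simp add: W_def \<rho>_def prob_space)
  next
    case True
    define Ku where "Ku = (\<Sum>i\<in>I. u i powr \<alpha>)"
    define Kv where "Kv = (\<Sum>i\<in>I. v i powr \<alpha>)"
    define K where "K = (\<Sum>i\<in>I. u i powr (\<alpha> / 2) * v i powr (\<alpha> / 2))"
    \<comment> \<open>The contribution common to the three expected logarithms; it cancels in the
      mean of ln W.\<close>
    define \<kappa> where "\<kappa> = (\<integral>s. (exp (- s) - exp (- (s powr (\<alpha> / 2)))) / s * indicator {0<..} s \<partial>lborel)"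
    have "0 < (\<Sum>i\<in>I. w i powr \<alpha>)" if w: "\<exists>i\<in>I. 0 < w i" for w :: "'i \<Rightarrow> real"
    proof -
      obtain i where "i \<in> I" "0 < w i" using w by blast
      thus ?thesis using I by (intro sum_pos2[of I i]) auto
    qed
    hence Ku: "0 < Ku" and Kv: "0 < Kv" using u(2) v(2) by (simp_all add: Ku_def Kv_def)
    have K: "0 < K"
    proof -
      obtain i where "i \<in> I" "0 < u i * v i" using True by blast
      thus ?thesis unfolding K_def using I by (intro sum_pos2[of I i]) (auto simp: zero_less_mult_iff)
    qed
    have Suv: "0 < Suv \<omega>" if "\<omega> \<in> space M" for \<omega>
      unfolding Suv_def using u(1) v(1) by (intro sum_mult_pos I True T_pos[OF _ that] mult_nonneg_nonneg)
    have sq: "(w\<^sup>2) powr (\<alpha> / 2) = w powr \<alpha>" if "0 \<le> w" for w :: real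
      using that by (metis field_sum_of_halves powr_add power2_eq_square powr_mult)
    have uv: "integrable M (\<lambda>\<omega>. ln (Suv \<omega>))" "expectation (\<lambda>\<omega>. ln (Suv \<omega>)) = ln K / (\<alpha> / 2) + \<kappa>"
    proof -
      have "K = (\<Sum>i\<in>I. (u i * v i) powr (\<alpha> / 2))"
        unfolding K_def using u(1) v(1) by (intro sum.cong refl) (simp add: powr_mult)
      thus "integrable M (\<lambda>\<omega>. ln (Suv \<omega>))" "expectation (\<lambda>\<omega>. ln (Suv \<omega>)) = ln K / (\<alpha> / 2) + \<kappa>"
        using expectation_ln_stable_sum[OF I T_indep T_pos T_laplace _ _ True] \<alpha> u(1) v(1)
        by (simp_all add: Suv_def \<kappa>_def)
    qed
    have uu': "integrable M (\<lambda>\<omega>. ln (Suu \<omega>))" "expectation (\<lambda>\<omega>. ln (Suu \<omega>)) = ln Ku / (\<alpha> / 2) + \<kappa>"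
      using expectation_ln_stable_sum[OF I T_indep T_pos T_laplace _ _ uu] \<alpha> u(1)
      by (simp_all add: Suu_def Ku_def \<kappa>_def sq cong: sum.cong)
    have vv': "integrable M (\<lambda>\<omega>. ln (Svv \<omega>))" "expectation (\<lambda>\<omega>. ln (Svv \<omega>)) = ln Kv / (\<alpha> / 2) + \<kappa>"
      using expectation_ln_stable_sum[OF I T_indep T_pos T_laplace _ _ vv] \<alpha> v(1)
      by (simp_all add: Svv_def Kv_def \<kappa>_def sq cong: sum.cong)
    have Wpos: "0 < W \<omega>" if "\<omega> \<in> space M" for \<omega>
      using Suu[OF that] Svv[OF that] Suv[OF that] by (simp add: W_def)
    have lnW: "ln (W \<omega>) = ln (Suv \<omega>) - ln (Suu \<omega>) / 2 - ln (Svv \<omega>) / 2" if "\<omega> \<in> space M" for \<omega>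
      using Suu[OF that] Svv[OF that] Suv[OF that] by (simp add: W_def ln_div ln_mult ln_sqrt add_divide_distrib)
    have \<rho>: "\<rho> = (K / sqrt (Ku * Kv)) powr (2 / \<alpha>)" by (simp add: \<rho>_def K_def Ku_def Kv_def)
    hence \<rho>_pos: "0 < \<rho>" using K Ku Kv by simp
    have ln\<rho>: "ln \<rho> = (ln K - ln Ku / 2 - ln Kv / 2) / (\<alpha> / 2)"
      using K Ku Kv by (simp add: \<rho> ln_powr ln_div ln_mult ln_sqrt add_divide_distrib)
    have int: "integrable M (\<lambda>\<omega>. ln (W \<omega>))"
      using uv uu' vv' by (subst Bochner_Integration.integrable_cong[OF refl lnW]) auto
    have ElnW: "expectation (\<lambda>\<omega>. ln (W \<omega>)) = ln \<rho>"
      using uv uu' vv' \<alpha> by (subst Bochner_Integration.integral_cong[OF refl lnW]) (auto simp: ln\<rho> field_simps)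
    have neg: "ln (W \<omega>) \<le> 0" if "\<omega> \<in> space M" for \<omega> using W(2)[OF that] Wpos[OF that] by simp
    \<comment> \<open>The bound \<rho> \<le> 1 is inherited from W \<le> 1 by way of E ln W = ln
      \<rho>, without a separate Cauchy-Schwarz argument for the powers of u and v.\<close>
    have "expectation (\<lambda>\<omega>. ln (W \<omega>)) \<le> expectation (\<lambda>\<omega>. 0)"
      using neg int by (intro integral_mono) auto
    hence "ln \<rho> \<le> 0" using ElnW by simp
    hence \<rho>_le: "\<rho> \<le> 1" using \<rho>_pos by simp
    show ?thesis
    proof (cases "\<rho> = 1")
      \<comment> \<open>Here - ln W is nonnegative with mean 0, so W = 1 almost everywhere and the
        expected angle vanishes.\<close>
      case True
      have "integral\<^sup>L M (\<lambda>\<omega>. - ln (W \<omega>)) = 0" using int ElnW True by simp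
      hence "AE \<omega> in M. - ln (W \<omega>) = 0"
        using int neg by (subst (asm) integral_nonneg_eq_0_iff_AE) auto
      hence "AE \<omega> in M. arccos (W \<omega>) = 0"
        using AE_space by eventually_elim (use Wpos in \<open>force simp: ln_eq_zero_iff\<close>)
      hence "expectation (\<lambda>\<omega>. arccos (W \<omega>)) = 0" by (rule integral_eq_zero_AE)
      thus ?thesis using True by simp
    next
      case False
      have "expectation (\<lambda>\<omega>. arccos (W \<omega>)) \<le> expectation (\<lambda>\<omega>. arccos \<rho> - cot (arccos \<rho>) * (ln (W \<omega>) - ln \<rho>))"
      proof (rule integral_mono)
        show "integrable M (\<lambda>\<omega>. arccos \<rho> - cot (arccos \<rho>) * (ln (W \<omega>) - ln \<rho>))" using int by simp
        show "arccos (W \<omega>) \<le> arccos \<rho> - cot (arccos \<rho>) * (ln (W \<omega>) - ln \<rho>)" if "\<omega> \<in> space M" for \<omega>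
          using False \<rho>_le \<rho>_pos Wpos[OF that] W(2)[OF that] by (intro arccos_le_ln_tangent) auto
        \<comment> \<open>The arccosine is known to be continuous only on [- 1, 1]. Clamping its
          argument gives a function continuous on the whole line, hence measurable, that agrees with
          arccos on the range of W.\<close>
        let ?a = "\<lambda>w :: real. arccos (max (- 1) (min 1 w))"
        have "continuous_on UNIV ?a" by (intro continuous_intros) auto
        hence [measurable]: "?a \<in> borel_measurable borel" by (rule borel_measurable_continuous_onI)
        have "integrable M (\<lambda>\<omega>. ?a (W \<omega>))"
        proof (rule integrable_const_bound[where B = pi])
          show "AE \<omega> in M. norm (?a (W \<omega>)) \<le> pi"
            using arccos_lbound arccos_ubound by (intro AE_I2) (simp add: abs_le_iff)
        qed measurable
        thus "integrable M (\<lambda>\<omega>. arccos (W \<omega>))"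
          using W by (subst Bochner_Integration.integrable_cong[OF refl, of _ _ "\<lambda>\<omega>. ?a (W \<omega>)"]) (auto simp: min_absorb2 max_absorb2 order_trans[of "- 1" 0])
      qed
      also have "\<dots> = arccos \<rho>" using int ElnW by (simp add: prob_space)
      finally show ?thesis .
    qed
  qed
  thus ?thesis by (simp add: W_def Suu_def Svv_def Suv_def)
qed

theorem theorem1:
  fixes M :: "'a measure" and \<alpha> :: real and D :: nat
    and u v :: "nat \<Rightarrow> real"
    and r T :: "nat \<Rightarrow> 'a \<Rightarrow> real"
  assumes "prob_space M"
    and "0 < \<alpha>" and "\<alpha> < 2" and "D \<ge> 1"
    and "\<forall>i<D. u i \<ge> 0" and "\<forall>i<D. v i \<ge> 0"
    and "\<exists>i<D. u i > 0" and "\<exists>i<D. v i > 0"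
    and r_indep: "prob_space.indep_vars M (\<lambda>_. borel) r {..<D}"
    and r_char: "\<forall>i<D. \<forall>t::real.
        char (distr M borel (r i)) t = complex_of_real (exp (- (\<bar>t\<bar> powr \<alpha>)))"
    and T_indep: "prob_space.indep_vars M (\<lambda>_. borel) T {..<D}"
    and T_pos: "\<forall>i<D. \<forall>\<omega>\<in>space M. T i \<omega> > 0"
    and T_laplace: "\<forall>i<D. \<forall>s::real. s \<ge> 0 \<longrightarrow>
        prob_space.expectation M (\<lambda>\<omega>. exp (- s * T i \<omega>)) = exp (- (s powr (\<alpha> / 2)))"
  defines "x \<equiv> (\<lambda>\<omega>. \<Sum>i<D. u i * r i \<omega>)"
    and "y \<equiv> (\<lambda>\<omega>. \<Sum>i<D. v i * r i \<omega>)"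
    and "\<rho> \<equiv> ((\<Sum>i<D. u i powr (\<alpha> / 2) * v i powr (\<alpha> / 2))
              / sqrt ((\<Sum>i<D. u i powr \<alpha>) * (\<Sum>i<D. v i powr \<alpha>))) powr (2 / \<alpha>)"
  shows "measure M {\<omega> \<in> space M. sgn (x \<omega>) \<noteq> sgn (y \<omega>)}
           = prob_space.expectation M (\<lambda>\<omega>. (1 / pi) * arccos
               ((\<Sum>i<D. u i * v i * T i \<omega>)
                / sqrt ((\<Sum>i<D. (u i)\<^sup>2 * T i \<omega>) * (\<Sum>i<D. (v i)\<^sup>2 * T i \<omega>))))
       \<and> prob_space.expectation M (\<lambda>\<omega>. (1 / pi) * arccos
               ((\<Sum>i<D. u i * v i * T i \<omega>)
                / sqrt ((\<Sum>i<D. (u i)\<^sup>2 * T i \<omega>) * (\<Sum>i<D. (v i)\<^sup>2 * T i \<omega>))))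
           \<le> (1 / pi) * arccos \<rho>"
proof -
  interpret prob_space M by fact
  have arr: "1 / pi * arccos a = arccos a / pi" for a :: real by simp
  have "measure M {\<omega> \<in> space M. sgn (x \<omega>) \<noteq> sgn (y \<omega>)}
    = expectation (\<lambda>\<omega>. arccos ((\<Sum>i<D. u i * v i * T i \<omega>)
        / sqrt ((\<Sum>i<D. (u i)\<^sup>2 * T i \<omega>) * (\<Sum>i<D. (v i)\<^sup>2 * T i \<omega>))) / pi)"
    unfolding x_def y_def using assms(5-8) r_char T_pos T_laplace
    by (intro prob_sgn_neq_stable_sums[OF _ _ _ _ _ r_indep _ T_indep]) auto
  moreover have "expectation (\<lambda>\<omega>. arccos ((\<Sum>i<D. u i * v i * T i \<omega>)
        / sqrt ((\<Sum>i<D. (u i)\<^sup>2 * T i \<omega>) * (\<Sum>i<D. (v i)\<^sup>2 * T i \<omega>)))) \<le> arccos \<rho>"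
    unfolding \<rho>_def using assms(2,5-8) T_pos T_laplace
    by (intro expectation_arccos_stable_le[OF _ _ _ _ _ _ T_indep]) auto
  ultimately show ?thesis
    unfolding arr by (simp add: divide_right_mono)
qed

end
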